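(* For every $\varepsilon>0$ there are sets $S,A\subseteq\mathbb F_2^{\omega}$ such that $d^*(A)>1-\varepsilon$, every translate of $S$ is chromatically intersective, and $S+A$ is not piecewise syndetic.
   Context: $\mathbb F_2^{\omega}=\bigoplus_{n=1}^{\infty}\mathbb F_2$ is the countable direct sum of copies of the two-element field, viewed as a countable abelian group. For subsets of an abelian group $G$ and $t\in G$: $A+B=\{a+b:a\in A,b\in B\}$, $A-A=\{a-b:a,b\in A\}$, and the translate $t+A=\{t+a:a\in A\}$. A Følner sequence for a countable abelian group $G$ is a sequence $\mathbf\Phi=(\Phi_n)_{n\in\mathbb N}$ of finite (nonempty) subsets of $G$ with $\lim_{n\to\infty}\frac{|(\Phi_n+g)\cap\Phi_n|}{|\Phi_n|}=1$ for every $g\in G$. The upper Banach density of $A\subseteq G$ is $d^*(A)=\sup_{\mathbf\Phi}\limsup_{n\to\infty}\frac{|A\cap\Phi_n|}{|\Phi_n|}$, the supremum being over all Følner sequences for $G$. A set $S\subseteq G$ is chromatically intersective if for every partition of $G$ into finitely many sets $A_1,\dots,A_r$ there exists $i\le r$ such that $(A_i-A_i)\cap S$ contains a nonzero element of $G$. A set $B\subseteq G$ is syndetic if $G$ is the union of finitely many translates of $B$. $B\subseteq G$ is piecewise syndetic if there is a syndetic set $B'\subseteq G$ such that for every finite $F\subseteq B'$ there exists $t\in G$ with $t+F\subseteq B$. *)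

theory Defs
  imports
    "HOL-Analysis.Analysis"
    "HOL-Library.Poly_Mapping"
    "HOL-Library.Z2"
    "HOL-Library.Set_Algebras"
    "HOL-Library.Disjoint_Sets"
begin

text \<open>
  The coordinates are indexed from \<open>0\<close>; addition of finitely supported functions is pointwise.
\<close>

type_synonym F2_omega = "nat \<Rightarrow>\<^sub>0 bit"

text \<open>
  The sumset \<open>A + B\<close> and the translate \<open>t +o A\<close> come from \<open>Set_Algebras\<close>.  On sets, however,
  \<open>A - A\<close> denotes the set-theoretic difference, so the algebraic one needs its own name.
\<close>

definition difference_set :: "'a::ab_group_add set \<Rightarrow> 'a set" where
  "difference_set A = {a - b | a b. a \<in> A \<and> b \<in> A}"

definition folner_seq :: "(nat \<Rightarrow> 'a::ab_group_add set) \<Rightarrow> bool" where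
  "folner_seq \<Phi> \<longleftrightarrow>
     (\<forall>n. finite (\<Phi> n) \<and> \<Phi> n \<noteq> {}) \<and>
     (\<forall>g. (\<lambda>n. real (card ((g +o \<Phi> n) \<inter> \<Phi> n)) / real (card (\<Phi> n))) \<longlonglongrightarrow> 1)"

text \<open>
  The density is \<open>ereal\<close>-valued, so that the limit superior and the supremum are the
  complete-lattice operations.  On a countable abelian group, where Folner sequences exist,
  the value lies in \<open>[0, 1]\<close>.
\<close>

definition upper_banach_density :: "'a::ab_group_add set \<Rightarrow> ereal" where
  "upper_banach_density A =
     (SUP \<Phi>\<in>{\<Phi>. folner_seq \<Phi>}.
        limsup (\<lambda>n. ereal (real (card (A \<inter> \<Phi> n)) / real (card (\<Phi> n)))))"

text \<open>
  The predicate \<open>partition_on\<close> requires nonempty blocks; empty blocks would not matter here,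
  as their difference sets are empty.
\<close>

definition chromatically_intersective :: "'a::ab_group_add set \<Rightarrow> bool" where
  "chromatically_intersective S \<longleftrightarrow>
     (\<forall>P. finite P \<and> partition_on UNIV P \<longrightarrow>
        (\<exists>A\<in>P. \<exists>x\<in>difference_set A \<inter> S. x \<noteq> 0))"

definition syndetic :: "'a::ab_group_add set \<Rightarrow> bool" where
  "syndetic B \<longleftrightarrow> (\<exists>T. finite T \<and> (\<Union>t\<in>T. t +o B) = UNIV)"

definition piecewise_syndetic :: "'a::ab_group_add set \<Rightarrow> bool" where
  "piecewise_syndetic B \<longleftrightarrow>
     (\<exists>B'. syndetic B' \<and> (\<forall>F. finite F \<and> F \<subseteq> B' \<longrightarrow> (\<exists>t. t +o F \<subseteq> B)))"

end

theory Submission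
  imports Defs "HOL-Library.Nat_Bijection"
begin

text \<open>
  Every element \<open>x\<close> of \<open>\<bbbF>\<^sub>2\<^sup>\<omega>\<close> is its own negative, so a finitely supported vector is the same as a finite
  set of coordinates and addition is symmetric difference.  Choose consecutive, very long blocks of
  coordinates, a slowly growing radius \<open>r m\<close> for the \<open>m\<close>-th block, and a sequence \<open>t m\<close> of vectors
  supported before the \<open>m\<close>-th block that takes every value for arbitrarily large radii.

  The set \<open>S\<close> (named \<open>jumps\<close>) consists of all \<open>t m + u\<close> where \<open>u\<close> lives on block \<open>m\<close> and fills it up to at
  most \<open>r m\<close> coordinates.  If \<open>t m = x\<close>, then \<open>x + S\<close> contains all these \<open>u\<close>.  In a colouring of the
  subsets of a block with at most \<open>r m\<close> colours, some two disjoint sets that together miss fewer than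
  \<open>r m\<close> coordinates have the same colour (\<open>nearly_complementary_monochromatic\<close>); their sum is such a
  \<open>u\<close>, so every translate of \<open>S\<close> is chromatically intersective.  This is a relative of Lovasz's theorem
  on Kneser graphs.  It follows from Tucker's lemma for the octahedral sphere, whose proof here is Ky
  Fan's parity argument: among the maximal chains of sign vectors, the number of those with
  alternating labels is odd.

  For the other two properties call a vector \<open>mid\<close> on a block if its weight there is close to half of
  the block, and heavy if its weight there is more than half.  If all \<open>t m\<close> were \<open>0\<close>, one would take for \<open>A\<close> the
  vectors that are \<open>mid\<close> on no block: this has density close to \<open>1\<close> since a random subset of a long
  block is rarely balanced, and adding an element of \<open>S\<close> changes just one block, so that every
  element of \<open>S + A\<close> is \<open>mid\<close> on at most one block.  This is impossible for a piecewise syndetic set,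
  because finitely many translations suffice to make any vector \<open>mid\<close> on two prescribed blocks.

  General \<open>t m\<close> are absorbed by a change of variables.  The bijection \<open>normal\<close> runs through the
  blocks from the last to the first and adds \<open>t m\<close> when block \<open>m\<close> of the current vector is heavy.  Adding \<open>t m + u\<close> to a
  vector whose block \<open>m\<close> is not \<open>mid\<close> changes the heaviness of block \<open>m\<close>, hence creates one more or
  one fewer \<open>t m\<close>, which cancels the \<open>t m\<close> that was added: \<open>normal\<close> sees only the addition of \<open>u\<close>
  (\<open>untwist_jump\<close>).  So \<open>A\<close> is the set \<open>unbalanced\<close> of the \<open>x\<close> for which \<open>normal x\<close> is \<open>mid\<close> on no
  block.  Its density is unaffected (\<open>unbalanced_density\<close>), because \<open>normal\<close> permutes the subgroups of
  vectors supported on the first \<open>N\<close> blocks, and these form a Folner sequence.  The argument on \<open>S + A\<close>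
  survives too (\<open>not_piecewise_syndetic\<close>), because blocks can be adjusted from the top down.
\<close>

section \<open>Alternating sequences of labels\<close>

definition drop_nth :: "nat \<Rightarrow> 'a list \<Rightarrow> 'a list" where
  "drop_nth i xs = take i xs @ drop (Suc i) xs"

fun alternating :: "bool \<Rightarrow> nat list \<Rightarrow> bool" where
  "alternating b [] = True"
| "alternating b (x # xs) = (odd x = b \<and> alternating (\<not> b) xs)"

text \<open>
  A natural number codes a signed label: its sign is the parity and its absolute value is the half,
  rounded down.  The usual order then sorts labels by absolute value, and two labels of the same
  absolute value are equal or opposite.
\<close>
definition opp :: "nat \<Rightarrow> nat" where
  "opp x = (if even x then x + 1 else x - 1)"

lemma drop_nth_0 [simp]: "drop_nth 0 (x # xs) = xs"
  by (simp add: drop_nth_def)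

lemma drop_nth_Suc [simp]: "drop_nth (Suc i) (x # xs) = x # drop_nth i xs"
  by (simp add: drop_nth_def)

lemma drop_nth_map: "drop_nth i (map f xs) = map f (drop_nth i xs)"
  by (simp add: drop_nth_def take_map drop_map)

lemma set_drop_nth_upt: "set (drop_nth i [0..<n]) = {..<n} - {i}"
proof -
  have "take i [0..<n] = [0..<min i n]"
    by (simp add: take_upt min_def)
  then show ?thesis
    by (auto simp: drop_nth_def)
qed

lemma set_drop_nth_subset: "set (drop_nth i xs) \<subseteq> set xs"
  by (auto simp: drop_nth_def dest: in_set_takeD in_set_dropD)

lemma sorted_drop_nth: "sorted xs \<Longrightarrow> sorted (drop_nth i xs)"
proof (induction xs arbitrary: i)
  case (Cons x xs)
  then show ?case
    using set_drop_nth_subset by (cases i) fastforce+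
qed (simp add: drop_nth_def)

lemma mset_drop_nth: "i < length xs \<Longrightarrow> mset (drop_nth i xs) = mset xs - {#xs ! i#}"
  by (metis add_mset_remove_trivial drop_nth_def id_take_nth_drop mset.simps(2) mset_append union_mset_add_mset_right)

lemma sum_drop_nth_mset:
  "(\<Sum>i<length xs. g (mset (drop_nth i xs))) = (\<Sum>x\<in>#mset xs. g (mset xs - {#x#}))"
proof -
  have "(\<Sum>i<length xs. g (mset (drop_nth i xs))) = (\<Sum>i<length xs. g (mset xs - {#xs ! i#}))"
    by (intro sum.cong) (auto simp: mset_drop_nth)
  also have "\<dots> = sum_list (map (\<lambda>x. g (mset xs - {#x#})) xs)"
    by (simp add: sum_list_sum_nth atLeast0LessThan)
  finally show ?thesis
    by (simp flip: sum_mset_sum_list)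
qed

text \<open>
  An alternating sequence stays alternating if its first or its last entry is dropped, and exactly
  one of these deletions leaves the starting sign \<open>b\<close>; a sequence that is not alternating has an even
  number of deletions that leave an alternating sequence with starting sign \<open>b\<close>.  In the induction
  the deletion of the head is split off.
\<close>
lemma sum_alternating_drop_nth:
  assumes "xs \<noteq> []"
  shows "(\<Sum>i<length xs. of_bool (alternating b (drop_nth i xs)) :: bit) =
           of_bool (alternating b xs) + of_bool (alternating (\<not> b) xs)"
  using assms
proof (induction xs arbitrary: b)
  case (Cons x xs)
  have "(\<Sum>i<length (x # xs). of_bool (alternating b (drop_nth i (x # xs))) :: bit) =
          of_bool (alternating b xs) + 
          (if odd x = b then (\<Sum>i<length xs. of_bool (alternating (\<not> b) (drop_nth i xs))) else 0)"
    by (simp add: sum.lessThan_Suc_shift del: sum.lessThan_Suc)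
  then show ?case
    using Cons.IH[of "\<not> b"] by (cases "xs = []") auto
qed simp

text \<open>
  Sorting depends only on the multiset of entries, so deleting and then sorting runs through the same
  lists as sorting and then deleting.
\<close>
lemma sum_alternating_sort_drop_nth:
  assumes "xs \<noteq> []"
  shows "(\<Sum>i<length xs. of_bool (alternating b (sort (drop_nth i xs))) :: bit) =
           of_bool (alternating b (sort xs)) + of_bool (alternating (\<not> b) (sort xs))"
proof -
  define g :: "nat multiset \<Rightarrow> bit"
    where "g M = of_bool (alternating b (sorted_list_of_multiset M))" for M
  have "(\<Sum>i<length xs. of_bool (alternating b (sort (drop_nth i xs))) :: bit) =
        (\<Sum>i<length xs. g (mset (drop_nth i xs)))"
    by (simp add: g_def)
  also have "\<dots> = (\<Sum>i<length (sort xs). g (mset (drop_nth i (sort xs))))"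
    unfolding sum_drop_nth_mset by simp
  also have "\<dots> = (\<Sum>i<length (sort xs). of_bool (alternating b (drop_nth i (sort xs))))"
    by (simp add: g_def sorted_sort_id sorted_drop_nth)
  also have "\<dots> = of_bool (alternating b (sort xs)) + of_bool (alternating (\<not> b) (sort xs))"
    by (rule sum_alternating_drop_nth) (use assms in \<open>metis length_0_conv length_sort\<close>)
  finally show ?thesis .
qed

lemma opp_mono: "x \<le> y \<Longrightarrow> y \<noteq> opp x \<Longrightarrow> opp x \<le> opp y"
  unfolding opp_def by (auto elim!: evenE oddE split: if_splits)

lemma sort_opp:
  assumes "\<And>x y. x \<in> set xs \<Longrightarrow> y \<in> set xs \<Longrightarrow> y \<noteq> opp x"
  shows "sort (map opp xs) = map opp (sort xs)"
proof (rule properties_for_sort)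
  have "sorted_wrt (\<lambda>x y. opp x \<le> opp y) (sort xs)"
    by (rule sorted_wrt_mono_rel[OF _ sorted_sort]) (use assms opp_mono in auto)
  then show "sorted (map opp (sort xs))"
    by (simp add: sorted_map)
qed simp

lemma alternating_map_opp: "alternating b (map opp xs) \<longleftrightarrow> alternating (\<not> b) xs"
  by (induction xs arbitrary: b) (auto simp: opp_def)

lemma alternating_sorted_strict:
  assumes "sorted xs" "alternating b xs"
    and "\<And>x y. x \<in> set xs \<Longrightarrow> y \<in> set xs \<Longrightarrow> y \<noteq> opp x"
  shows "sorted_wrt (\<lambda>x y. x div 2 < y div 2) xs"
  using assms
proof (induction xs arbitrary: b)
  case (Cons x xs)
  have IH: "sorted_wrt (\<lambda>x y. x div 2 < y div 2) xs"
    using Cons.prems by (intro Cons.IH[of "\<not> b"]) auto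
  have "x div 2 < y div 2" if "y \<in> set xs" for y
  proof (cases xs)
    case (Cons z zs)
    have "odd x \<noteq> odd z" "x \<le> z" "z \<noteq> opp x"
      using Cons.prems local.Cons by auto
    then have "x div 2 < z div 2"
      by (auto simp: opp_def elim!: evenE oddE split: if_splits)
    then show ?thesis
      using IH that local.Cons by fastforce
  qed (use that in simp)
  then show ?case
    using IH by simp
qed simp

text \<open>
  Neighbours in a sorted alternating list have different signs; as opposite labels are excluded, the
  absolute values are strictly increasing, and so there are at least as many of them as entries.
\<close>
lemma alternating_length:
  assumes "alternating b (sort xs)"
    and "\<And>x y. x \<in> set xs \<Longrightarrow> y \<in> set xs \<Longrightarrow> y \<noteq> opp x"
    and "\<And>x. x \<in> set xs \<Longrightarrow> x div 2 < m"
  shows "length xs \<le> m"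
proof -
  have "sorted_wrt (\<lambda>x y. x div 2 < y div 2) (sort xs)"
    using assms by (intro alternating_sorted_strict[of _ b]) auto
  then have "sorted_wrt (<) (map (\<lambda>x. x div 2) (sort xs))"
    by (simp add: sorted_wrt_map)
  then have "distinct (map (\<lambda>x. x div 2) (sort xs))"
    by (simp add: strict_sorted_iff)
  then have "length xs = card (set (map (\<lambda>x. x div 2) (sort xs)))"
    by (metis distinct_card length_map length_sort)
  also have "\<dots> \<le> card {..<m}"
    by (rule card_mono) (use assms(3) in auto)
  finally show ?thesis by simp
qed

section \<open>Flags of sign vectors\<close>

text \<open>
  A sign vector in \<open>{+, -, 0}\<^sup>n\<close> is the set of its nonzero coordinates paired with their signs.  The
  nonzero sign vectors, ordered by inclusion, form the barycentric subdivision of the octahedral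
  sphere of dimension \<open>n - 1\<close>.  A maximal chain adds one coordinate at a time, so it is a permutation
  of the coordinates with signs attached, and its members are the sets of entries of the prefixes.
\<close>
definition signed_perms :: "nat \<Rightarrow> (nat \<times> bool) list set" where
  "signed_perms d = {\<pi>. distinct (map fst \<pi>) \<and> fst ` set \<pi> = {..<d}}"

definition sign_vectors :: "nat \<Rightarrow> (nat \<times> bool) set set" where
  "sign_vectors n = {X. X \<noteq> {} \<and> inj_on fst X \<and> fst ` X \<subseteq> {..<n}}"

definition flag_labels :: "((nat \<times> bool) set \<Rightarrow> nat) \<Rightarrow> (nat \<times> bool) list \<Rightarrow> nat list" where
  "flag_labels l \<pi> = map (\<lambda>i. l (set (take (Suc i) \<pi>))) [0..<length \<pi>]"

lemma length_signed_perms: "\<pi> \<in> signed_perms d \<Longrightarrow> length \<pi> = d"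
  using distinct_card[of "map fst \<pi>"] by (simp add: signed_perms_def)

lemma finite_signed_perms: "finite (signed_perms d)"
proof (rule finite_subset)
  show "signed_perms d \<subseteq> {\<pi>. set \<pi> \<subseteq> {..<d} \<times> UNIV \<and> length \<pi> = d}"
  proof
    fix \<pi> assume \<pi>: "\<pi> \<in> signed_perms d"
    then have "set \<pi> \<subseteq> fst ` set \<pi> \<times> UNIV"
      by force
    then show "\<pi> \<in> {\<pi>. set \<pi> \<subseteq> {..<d} \<times> UNIV \<and> length \<pi> = d}"
      using \<pi> length_signed_perms[OF \<pi>] by (simp add: signed_perms_def)
  qed
qed (simp add: finite_lists_length_eq)

lemma signed_perms_mset_cong:
  assumes "mset \<pi> = mset \<rho>"
  shows "\<pi> \<in> signed_perms d \<longleftrightarrow> \<rho> \<in> signed_perms d"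
proof -
  have "mset (map fst \<pi>) = mset (map fst \<rho>)" "set \<pi> = set \<rho>"
    using assms by (simp, metis mset_eq_setD)
  then show ?thesis
    unfolding signed_perms_def mem_Collect_eq using mset_eq_imp_distinct_iff[of "map fst \<pi>" "map fst \<rho>"] by simp
qed

lemma signed_perms_snoc:
  assumes "\<pi> \<in> signed_perms (Suc d)" "fst (\<pi> ! d) = d" "(d, True) \<in> set \<pi>"
  shows "\<exists>\<rho>\<in>signed_perms d. \<pi> = \<rho> @ [(d, True)]"
proof -
  have len: "length \<pi> = Suc d"
    by (rule length_signed_perms[OF assms(1)])
  have dist: "distinct (map fst \<pi>)" and fsts: "fst ` set \<pi> = {..<Suc d}"
    using assms(1) by (auto simp: signed_perms_def)
  define \<rho> where "\<rho> = take d \<pi>"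
  have \<pi>: "\<pi> = \<rho> @ [\<pi> ! d]"
    using take_Suc_conv_app_nth[of d \<pi>] len by (simp add: \<rho>_def)
  have "\<pi> ! d \<in> set \<pi>" using len by simp
  then have last: "\<pi> ! d = (d, True)"
    using dist assms(2,3) inj_onD[of fst "set \<pi>" "\<pi> ! d" "(d, True)"] by (simp add: distinct_map)
  have \<pi>': "\<pi> = \<rho> @ [(d, True)]"
    using \<pi> last by simp
  have "distinct (map fst \<rho>)" "d \<notin> fst ` set \<rho>"
    using dist unfolding \<pi>' by auto
  moreover have "insert d (fst ` set \<rho>) = insert d {..<d}"
    using fsts unfolding \<pi>' by (simp add: lessThan_Suc)
  ultimately have "\<rho> \<in> signed_perms d"
    unfolding signed_perms_def by (simp add: insert_ident)
  then show ?thesis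
    using \<pi>' by blast
qed

lemma snoc_signed_perms:
  "\<rho> \<in> signed_perms d \<Longrightarrow> \<rho> @ [(d, b)] \<in> signed_perms (Suc d)"
  by (auto simp: signed_perms_def lessThan_Suc)

lemma map_flip_signed_perms_iff:
  "map (apsnd Not) \<pi> \<in> signed_perms d \<longleftrightarrow> \<pi> \<in> signed_perms d"
  by (simp add: signed_perms_def comp_def image_image)

lemma set_take_sign_vector:
  assumes "\<pi> \<in> signed_perms d" "d \<le> n" "i < d"
  shows "set (take (Suc i) \<pi>) \<in> sign_vectors n"
proof -
  have "inj_on fst (set \<pi>)" "fst ` set \<pi> \<subseteq> {..<n}" "\<pi> \<noteq> []"
    using assms by (auto simp: signed_perms_def distinct_map)
  moreover have sub: "set (take (Suc i) \<pi>) \<subseteq> set \<pi>"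
    by (rule set_take_subset)
  ultimately show ?thesis
    unfolding sign_vectors_def using inj_on_subset[OF _ sub] image_mono[OF sub, of fst] by auto
qed

lemma flag_labels_no_opp:
  assumes \<pi>: "\<pi> \<in> signed_perms d" "d \<le> n"
    and opp: "\<And>X. X \<in> sign_vectors n \<Longrightarrow> l (apsnd Not ` X) = opp (l X)"
    and no_opp: "\<And>X Y. X \<in> sign_vectors n \<Longrightarrow> Y \<in> sign_vectors n \<Longrightarrow> X \<subseteq> Y \<Longrightarrow> l Y \<noteq> opp (l X)"
    and xy: "x \<in> set (flag_labels l \<pi>)" "y \<in> set (flag_labels l \<pi>)"
  shows "y \<noteq> opp x"
proof -
  have len: "length \<pi> = d"
    by (rule length_signed_perms[OF \<pi>(1)])
  obtain i j where ij: "i < d" "j < d" 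
    "x = l (set (take (Suc i) \<pi>))" "y = l (set (take (Suc j) \<pi>))"
    using xy len by (auto simp: flag_labels_def)
  have sv: "set (take (Suc i) \<pi>) \<in> sign_vectors n" "set (take (Suc j) \<pi>) \<in> sign_vectors n"
    using set_take_sign_vector[OF \<pi>] ij by auto
  have opp_opp: "opp (opp z) = z" for z
    by (simp add: opp_def)
  show ?thesis
  proof (cases "i \<le> j")
    case True
    then have "set (take (Suc i) \<pi>) \<subseteq> set (take (Suc j) \<pi>)"
      by (simp add: set_take_subset_set_take)
    then show ?thesis using no_opp[OF sv] ij by simp
  next
    case False
    then have "set (take (Suc j) \<pi>) \<subseteq> set (take (Suc i) \<pi>)"
      by (simp add: set_take_subset_set_take)
    then show ?thesis using no_opp[OF sv(2,1)] ij opp_opp by metis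
  qed
qed

lemma flag_labels_map_flip:
  assumes \<pi>: "\<pi> \<in> signed_perms d" "d \<le> n"
    and opp: "\<And>X. X \<in> sign_vectors n \<Longrightarrow> l (apsnd Not ` X) = opp (l X)"
  shows "flag_labels l (map (apsnd Not) \<pi>) = map opp (flag_labels l \<pi>)"
  unfolding flag_labels_def using opp[OF set_take_sign_vector[OF \<pi>]] length_signed_perms[OF \<pi>(1)]
  by (simp add: take_map)

lemma drop_nth_flag_labels_cong:
  assumes "length \<pi> = length \<rho>"
    and "\<And>j. j < length \<pi> \<Longrightarrow> j \<noteq> i \<Longrightarrow> set (take (Suc j) \<pi>) = set (take (Suc j) \<rho>)"
  shows "drop_nth i (flag_labels l \<pi>) = drop_nth i (flag_labels l \<rho>)"
  unfolding flag_labels_def drop_nth_map using assms by (auto simp: set_drop_nth_upt intro!: map_cong)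

text \<open>
  Omitting the \<open>i\<close>-th member of a maximal chain leaves a facet that lies in exactly one other maximal
  chain: the two coordinates added around that member are exchanged, or, if the top member is
  omitted, the last sign is flipped.  The map goes to this other chain.
\<close>
definition cross_facet :: "nat \<Rightarrow> (nat \<times> bool) list \<times> nat \<Rightarrow> (nat \<times> bool) list \<times> nat" where
  "cross_facet d = (\<lambda>(\<pi>, i). (if i < d then \<pi>[i := \<pi> ! Suc i, Suc i := \<pi> ! i]
                        else \<pi>[d := apsnd Not (\<pi> ! d)], i))"

lemma cross_facet_involution: "length \<pi> = Suc d \<Longrightarrow> i \<le> d \<Longrightarrow> cross_facet d (cross_facet d (\<pi>, i)) = (\<pi>, i)"
  by (auto simp: cross_facet_def list_eq_iff_nth_eq nth_list_update prod_eq_iff)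

lemma cross_facet_neq:
  assumes "\<pi> \<in> signed_perms (Suc d)" "i \<le> d"
  shows "cross_facet d (\<pi>, i) \<noteq> (\<pi>, i)"
proof -
  have len: "length \<pi> = Suc d"
    by (rule length_signed_perms[OF assms(1)])
  have "distinct \<pi>"
    using assms(1) by (auto simp: signed_perms_def distinct_map)
  show ?thesis
  proof (cases "i < d")
    case True
    then have "\<pi> ! i \<noteq> \<pi> ! Suc i"
      using \<open>distinct \<pi>\<close> len by (simp add: nth_eq_iff_index_eq)
    then have "\<pi>[i := \<pi> ! Suc i, Suc i := \<pi> ! i] ! i \<noteq> \<pi> ! i"
      using len True by (auto simp: nth_list_update)
    then have "\<pi>[i := \<pi> ! Suc i, Suc i := \<pi> ! i] \<noteq> \<pi>"
      by metis
    then show ?thesis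
      using True by (simp add: cross_facet_def)
  next
    case False
    have "\<pi>[d := apsnd Not (\<pi> ! d)] ! d \<noteq> \<pi> ! d"
      using len by (cases "\<pi> ! d") auto
    then have "\<pi>[d := apsnd Not (\<pi> ! d)] \<noteq> \<pi>"
      by metis
    then show ?thesis
      using False by (simp add: cross_facet_def)
  qed
qed

lemma cross_facet_signed_perms:
  assumes "\<pi> \<in> signed_perms (Suc d)" "i \<le> d"
  shows "fst (cross_facet d (\<pi>, i)) \<in> signed_perms (Suc d)"
proof -
  have len: "length \<pi> = Suc d"
    by (rule length_signed_perms[OF assms(1)])
  show ?thesis
  proof (cases "i < d")
    case True
    then have "mset (\<pi>[i := \<pi> ! Suc i, Suc i := \<pi> ! i]) = mset \<pi>"
      by (intro mset_swap) (use len in auto)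
    from signed_perms_mset_cong[OF this] show ?thesis
      using True assms(1) by (simp add: cross_facet_def)
  next
    case False
    have fsts: "map fst (\<pi>[d := apsnd Not (\<pi> ! d)]) = map fst \<pi>"
      using len by (auto simp: list_eq_iff_nth_eq nth_list_update)
    then have "fst ` set (\<pi>[d := apsnd Not (\<pi> ! d)]) = fst ` set \<pi>"
      unfolding list.set_map[symmetric] by (rule arg_cong)
    then show ?thesis
      using False assms(1) fsts by (simp add: cross_facet_def signed_perms_def)
  qed
qed

lemma cross_facet_preserves_mem:
  assumes "\<pi> \<in> signed_perms (Suc d)" "i \<le> d" "x \<in> set \<pi>" "i = d \<Longrightarrow> x \<noteq> \<pi> ! d"
  shows "x \<in> set (fst (cross_facet d (\<pi>, i)))"
proof -
  have len: "length \<pi> = Suc d"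
    by (rule length_signed_perms[OF assms(1)])
  show ?thesis
  proof (cases "i < d")
    case True
    then have "mset (\<pi>[i := \<pi> ! Suc i, Suc i := \<pi> ! i]) = mset \<pi>"
      by (intro mset_swap) (use len in auto)
    from mset_eq_setD[OF this] show ?thesis
      using True assms(3) by (simp add: cross_facet_def)
  next
    case False
    obtain j where "j < length \<pi>" "\<pi> ! j = x"
      using assms(3) by (auto simp: in_set_conv_nth)
    then have "\<pi>[d := apsnd Not (\<pi> ! d)] ! j = x"
      using assms(2,4) False by (metis le_neq_implies_less nth_list_update_neq)
    then show ?thesis
      using False \<open>j < length \<pi>\<close> by (auto simp: cross_facet_def in_set_conv_nth)
  qed
qed

text \<open>
  The two chains on both sides of a facet share it, so they have the same labels away from it.
\<close>
lemma drop_nth_flag_labels_cross_facet: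
  assumes "length \<pi> = Suc d" "i \<le> d"
  shows "drop_nth i (flag_labels l (fst (cross_facet d (\<pi>, i)))) = drop_nth i (flag_labels l \<pi>)"
proof (rule drop_nth_flag_labels_cong)
  fix j assume j: "j < length (fst (cross_facet d (\<pi>, i)))" "j \<noteq> i"
  show "set (take (Suc j) (fst (cross_facet d (\<pi>, i)))) = set (take (Suc j) \<pi>)"
  proof (cases "i < d")
    case True
    consider "j < i" | "i < j" using j by linarith
    then show ?thesis
    proof cases
      case 1
      then show ?thesis using True by (simp add: cross_facet_def)
    next
      case 2
      have "take (Suc j) (\<pi>[i := \<pi> ! Suc i, Suc i := \<pi> ! i]) = 
            (take (Suc j) \<pi>)[i := take (Suc j) \<pi> ! Suc i, Suc i := take (Suc j) \<pi> ! i]"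
        using 2 by (simp add: take_update_swap)
      moreover have "mset \<dots> = mset (take (Suc j) \<pi>)"
        using 2 j assms True by (intro mset_swap) (auto simp: cross_facet_def)
      ultimately have "mset (take (Suc j) (\<pi>[i := \<pi> ! Suc i, Suc i := \<pi> ! i])) = mset (take (Suc j) \<pi>)"
        by metis
      from mset_eq_setD[OF this] show ?thesis
        using True by (simp add: cross_facet_def)
    qed
  next
    case False
    then show ?thesis using j assms by (simp add: cross_facet_def)
  qed
qed (simp add: cross_facet_def)

section \<open>Fan's parity lemma and Tucker's lemma\<close>

lemma signed_perms_top_cases:
  assumes "\<pi> \<in> signed_perms (Suc d)"
  shows "(d, False) \<in> set \<pi> \<longleftrightarrow> (d, True) \<notin> set \<pi>"
proof -
  have "inj_on fst (set \<pi>)" "d \<in> fst ` set \<pi>"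
    using assms by (auto simp: signed_perms_def distinct_map)
  then have "\<not> ((d, False) \<in> set \<pi> \<and> (d, True) \<in> set \<pi>)"
    using inj_onD[of fst "set \<pi>" "(d, False)" "(d, True)"] by auto
  moreover obtain b where "(d, b) \<in> set \<pi>"
    using \<open>d \<in> fst ` set \<pi>\<close> by force
  ultimately show ?thesis
    by (cases b) auto
qed

text \<open>
  The induction compares the sphere of dimension \<open>d\<close> with its equator, where the last coordinate is
  \<open>0\<close>, by counting modulo \<open>2\<close>, that is in the type \<open>bit\<close>, the pairs of a maximal chain in the upper
  hemisphere and a facet of it with alternating labels starting with \<open>+\<close>.  Chain by chain, only the
  alternating chains contribute an odd number; those starting with \<open>-\<close> correspond under the antipodal
  map to chains starting with \<open>+\<close> in the lower hemisphere, so the count is the number of alternating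
  chains in the whole sphere.  Facet by facet, the interior facets lie in two chains and cancel, and
  the remaining facets are the maximal chains of the equator.
\<close>
theorem fan_parity:
  assumes opp: "\<And>X. X \<in> sign_vectors n \<Longrightarrow> l (apsnd Not ` X) = opp (l X)"
    and no_opp: "\<And>X Y. X \<in> sign_vectors n \<Longrightarrow> Y \<in> sign_vectors n \<Longrightarrow> X \<subseteq> Y \<Longrightarrow> l Y \<noteq> opp (l X)"
    and "d \<le> n"
  shows "(\<Sum>\<pi>\<in>signed_perms d. of_bool (alternating True (sort (flag_labels l \<pi>))) :: bit) = 1"
  using \<open>d \<le> n\<close>
proof (induction d)
  case 0
  have "signed_perms 0 = {[]}"
    by (auto simp: signed_perms_def)
  then show ?case by (simp add: flag_labels_def)
next
  case (Suc d)
  define P where "P = signed_perms (Suc d)"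
  (* The upper hemisphere.  The largest member of a maximal chain has no zero coordinate, so each
     chain lies in one of the two hemispheres. *)
  define H where "H = {\<pi> \<in> P. (d, True) \<in> set \<pi>}"
  define F :: "(nat \<times> bool) list \<times> nat \<Rightarrow> bit"
    where "F = (\<lambda>(\<pi>, i). of_bool (alternating True (sort (drop_nth i (flag_labels l \<pi>)))))"
  define A :: "bool \<Rightarrow> (nat \<times> bool) list \<Rightarrow> bit"
    where "A = (\<lambda>b \<pi>. of_bool (alternating b (sort (flag_labels l \<pi>))))"
  have fin: "finite P" "finite H"
    using finite_signed_perms by (auto simp: P_def H_def)
  have len: "length \<pi> = Suc d" if "\<pi> \<in> P" for \<pi>
    using that length_signed_perms by (simp add: P_def)
  have A_flip: "A False \<pi> = A True (map (apsnd Not) \<pi>)" if "\<pi> \<in> P" for \<pi>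
  proof -
    have \<pi>: "\<pi> \<in> signed_perms (Suc d)"
      using that by (simp add: P_def)
    have flip: "flag_labels l (map (apsnd Not) \<pi>) = map opp (flag_labels l \<pi>)"
      by (rule flag_labels_map_flip[OF \<pi> Suc.prems]) (rule opp)
    have "sort (map opp (flag_labels l \<pi>)) = map opp (sort (flag_labels l \<pi>))"
      by (rule sort_opp) (rule flag_labels_no_opp[where l = l, OF \<pi> Suc.prems opp no_opp])
    then have "sort (flag_labels l (map (apsnd Not) \<pi>)) = map opp (sort (flag_labels l \<pi>))"
      by (simp only: flip)
    then show ?thesis
      by (simp add: A_def alternating_map_opp)
  qed
  have "(\<Sum>q\<in>H \<times> {..d}. F q) = (\<Sum>\<pi>\<in>H. \<Sum>i<Suc d. F (\<pi>, i))"
    by (simp add: sum.cartesian_product lessThan_Suc_atMost)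
  also have "\<dots> = (\<Sum>\<pi>\<in>H. A True \<pi> + A False \<pi>)"
  proof (rule sum.cong[OF refl])
    fix \<pi> assume "\<pi> \<in> H"
    then have l: "length (flag_labels l \<pi>) = Suc d"
      using len by (simp add: H_def flag_labels_def)
    show "(\<Sum>i<Suc d. F (\<pi>, i)) = A True \<pi> + A False \<pi>"
      using sum_alternating_sort_drop_nth[of "flag_labels l \<pi>" True] l
      unfolding F_def A_def by force
  qed
  also have "\<dots> = (\<Sum>\<pi>\<in>H. A True \<pi>) + (\<Sum>\<pi>\<in>P - H. A True \<pi>)"
  proof -
    have flip_P: "map (apsnd Not) \<pi> \<in> P \<longleftrightarrow> \<pi> \<in> P" for \<pi>
      by (simp add: P_def map_flip_signed_perms_iff)
    have flip_top: "(d, b) \<in> set (map (apsnd Not) \<pi>) \<longleftrightarrow> (d, \<not> b) \<in> set \<pi>" for \<pi> b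
      by force
    have flip_flip: "map (apsnd Not) (map (apsnd Not) \<pi>) = \<pi>" for \<pi> :: "(nat \<times> bool) list"
      by (simp add: comp_def apsnd_def map_prod_def case_prod_beta)
    have top: "(d, False) \<in> set \<pi> \<longleftrightarrow> (d, True) \<notin> set \<pi>" if "\<pi> \<in> P" for \<pi>
      using that signed_perms_top_cases by (simp add: P_def)
    have "(\<Sum>\<pi>\<in>H. A False \<pi>) = (\<Sum>\<pi>\<in>P - H. A True \<pi>)"
    proof (rule sum.reindex_bij_witness[where i = "map (apsnd Not)" and j = "map (apsnd Not)"])
      fix \<pi> assume \<pi>: "\<pi> \<in> H"
      then show "map (apsnd Not) \<pi> \<in> P - H"
        using \<pi> flip_P[of \<pi>] flip_top[of True \<pi>] top[of \<pi>] by (simp add: H_def)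
      show "A True (map (apsnd Not) \<pi>) = A False \<pi>"
        using \<pi> A_flip by (simp add: H_def)
    next
      fix \<pi> assume \<pi>: "\<pi> \<in> P - H"
      then show "map (apsnd Not) \<pi> \<in> H"
        using \<pi> flip_P[of \<pi>] flip_top[of True \<pi>] top[of \<pi>] by (simp add: H_def)
    qed (rule flip_flip)+
    then show ?thesis
      by (simp only: sum.distrib)
  qed
  also have "\<dots> = (\<Sum>\<pi>\<in>P. A True \<pi>)"
    by (subst sum.subset_diff[of H P "A True"]) (auto simp only: H_def add.commute fin(1))
  finally have inner: "(\<Sum>q\<in>H \<times> {..d}. F q) = (\<Sum>\<pi>\<in>P. A True \<pi>)" .
  (* The pairs whose facet lies in the equator: the last coordinate is added by the last step, which
     is the one left out. *)
  define E where "E = {(\<pi>, i) \<in> H \<times> {..d}. i = d \<and> fst (\<pi> ! d) = d}"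
  have "(\<Sum>q\<in>H \<times> {..d}. F q) = (\<Sum>q\<in>H \<times> {..d} - E. F q) + (\<Sum>q\<in>E. F q)"
    by (rule sum.subset_diff) (use fin in \<open>auto simp: E_def\<close>)
  also have "(\<Sum>q\<in>H \<times> {..d} - E. F q) = 0"
  proof (rule sum_involution_eq_0[where h = "cross_facet d"])
    fix q assume q: "q \<in> H \<times> {..d} - E"
    then obtain \<pi> i where [simp]: "q = (\<pi>, i)" and \<pi>: "\<pi> \<in> signed_perms (Suc d)" 
      "(d, True) \<in> set \<pi>" "i \<le> d" "i = d \<Longrightarrow> fst (\<pi> ! d) \<noteq> d"
      by (auto simp: E_def H_def P_def)
    have [simp]: "length \<pi> = Suc d"
      using length_signed_perms \<pi> by simp
    have snd: "snd (cross_facet d (\<pi>, i)) = i"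
      by (simp add: cross_facet_def)
    have "(d, True) \<noteq> \<pi> ! d" if "i = d"
      using \<pi>(4)[OF that] by (metis fst_conv)
    then have "fst (cross_facet d (\<pi>, i)) \<in> H"
      using cross_facet_signed_perms[OF \<pi>(1,3)] cross_facet_preserves_mem[OF \<pi>(1,3,2)]
      by (auto simp: H_def P_def)
    moreover have "fst (fst (cross_facet d (\<pi>, i)) ! d) \<noteq> d" if "i = d"
      using \<pi>(4)[OF that] that by (simp add: cross_facet_def)
    ultimately show "cross_facet d q \<in> H \<times> {..d} - E"
      using snd \<pi>(3) by (cases "cross_facet d (\<pi>, i)") (auto simp: E_def)
    show "cross_facet d (cross_facet d q) = q" "cross_facet d q \<noteq> q"
      using cross_facet_involution[of \<pi> d i] cross_facet_neq[OF \<pi>(1,3)] \<pi>(3) by auto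
    show "F (cross_facet d q) + F q = 0"
      using drop_nth_flag_labels_cross_facet[of \<pi> d i l] \<pi>(3) snd
      by (cases "cross_facet d (\<pi>, i)") (auto simp: F_def)
  qed
  also have "(\<Sum>q\<in>E. F q) = (\<Sum>\<rho>\<in>signed_perms d. A True \<rho>)"
  proof (rule sum.reindex_bij_witness[where i = "\<lambda>\<rho>. (\<rho> @ [(d, True)], d)" and j = "\<lambda>(\<pi>, i). take d \<pi>"])
    fix q assume q: "q \<in> E"
    then obtain \<rho> where \<rho>: "\<rho> \<in> signed_perms d" and [simp]: "q = (\<rho> @ [(d, True)], d)"
      using signed_perms_snoc[of _ d] by (auto simp: E_def H_def P_def)
    have [simp]: "length \<rho> = d"
      by (rule length_signed_perms[OF \<rho>])
    show "(case q of (\<pi>, i) \<Rightarrow> take d \<pi>) \<in> signed_perms d"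
      using \<rho> by simp
    show "((case q of (\<pi>, i) \<Rightarrow> take d \<pi>) @ [(d, True)], d) = q"
      by simp
    have "drop_nth d (flag_labels l (\<rho> @ [(d, True)])) = flag_labels l \<rho>"
      by (simp add: flag_labels_def drop_nth_def take_map)
    then show "A True (case q of (\<pi>, i) \<Rightarrow> take d \<pi>) = F q"
      by (simp add: A_def F_def)
  next
    fix \<rho> assume \<rho>: "\<rho> \<in> signed_perms d"
    then have [simp]: "length \<rho> = d"
      by (rule length_signed_perms)
    show "(\<rho> @ [(d, True)], d) \<in> E"
      using snoc_signed_perms[OF \<rho>] by (auto simp: E_def H_def P_def nth_append)
    show "(case (\<rho> @ [(d, True)], d) of (\<pi>, i) \<Rightarrow> take d \<pi>) = \<rho>"
      by simp
  qed
  also have "\<dots> = 1"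
    using Suc by (simp add: A_def)
  finally show ?case
    unfolding inner by (simp add: A_def P_def)
qed

text \<open>
  With fewer than \<open>n\<close> absolute values no maximal chain could be alternating, although the number of
  alternating chains would be odd if there were no two comparable sign vectors with opposite labels.
\<close>
theorem octahedral_tucker:
  assumes opp: "\<And>X. X \<in> sign_vectors n \<Longrightarrow> l (apsnd Not ` X) = opp (l X)"
    and bound: "\<And>X. X \<in> sign_vectors n \<Longrightarrow> l X div 2 < m" and "m < n"
  shows "\<exists>X\<in>sign_vectors n. \<exists>Y\<in>sign_vectors n. X \<subseteq> Y \<and> l Y = opp (l X)"
proof (rule ccontr)
  assume "\<not> ?thesis"
  then have no_opp: "\<And>X Y. X \<in> sign_vectors n \<Longrightarrow> Y \<in> sign_vectors n \<Longrightarrow> X \<subseteq> Y \<Longrightarrow> l Y \<noteq> opp (l X)"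
    by blast
  have "\<exists>\<pi>\<in>signed_perms n. alternating True (sort (flag_labels l \<pi>))"
  proof (rule ccontr)
    assume "\<not> ?thesis"
    then have "(\<Sum>\<pi>\<in>signed_perms n. of_bool (alternating True (sort (flag_labels l \<pi>))) :: bit) = 0"
      by simp
    then show False
      using fan_parity[where l = l, OF opp no_opp order_refl] by simp
  qed
  then obtain \<pi> where \<pi>: "\<pi> \<in> signed_perms n" and alt: "alternating True (sort (flag_labels l \<pi>))"
    by blast
  have "length (flag_labels l \<pi>) \<le> m"
  proof (rule alternating_length[OF alt])
    fix x assume "x \<in> set (flag_labels l \<pi>)"
    then obtain i where "i < n" "x = l (set (take (Suc i) \<pi>))"
      using length_signed_perms[OF \<pi>] by (auto simp: flag_labels_def)
    then show "x div 2 < m"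
      using bound set_take_sign_vector[OF \<pi> order_refl] by simp
  qed (rule flag_labels_no_opp[where l = l, OF \<pi> order_refl opp no_opp])
  then show False
    using length_signed_perms[OF \<pi>] \<open>m < n\<close> by (simp add: flag_labels_def)
qed

section \<open>Nearly complementary sets of one colour\<close>

text \<open>
  A sign vector stands for a pair of disjoint sets, its positive and its negative part.  If the
  theorem fails, the parts of every sign vector with fewer than \<open>k\<close> zeros have different
  colours, and the smaller of the two colours together with the part that has it is a signed label.
  That takes \<open>k - 1\<close> absolute values.  The \<open>n - k\<close> possible sizes of the other sign vectors give
  labels that cannot be opposite along a strict inclusion.  There are \<open>n - 1\<close> absolute values in all, so
  Tucker's lemma yields \<open>X \<subseteq> Y\<close> with opposite labels.  Then one part of \<open>X\<close> and the opposite part of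
  \<open>Y\<close> are disjoint, have the same colour and are jointly large.
\<close>
theorem nearly_complementary_monochromatic:
  fixes c :: "nat set \<Rightarrow> nat"
  assumes colours: "\<And>U. c U < k" and "k \<le> n"
  shows "\<exists>U V. U \<subseteq> {..<n} \<and> V \<subseteq> {..<n} \<and> U \<inter> V = {} \<and> n < card U + card V + k \<and> c U = c V"
proof (rule ccontr)
  assume none: "\<not> ?thesis"
  have "0 < k" using colours[of "{}"] by simp
  define part :: "bool \<Rightarrow> (nat \<times> bool) set \<Rightarrow> nat set" where "part b X = {i. (i, b) \<in> X}" for b X
  define top where "top X \<longleftrightarrow> n < card X + k" for X :: "(nat \<times> bool) set"
  (* For the sign vectors that are not top, the sign of the smallest coordinate serves as a sign that
     changes under the antipodal map. *)
  define l where "l X = (if top X 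
      then 2 * (n - k + min (c (part True X)) (c (part False X))) + of_bool (c (part True X) < c (part False X))
      else 2 * (card X - 1) + of_bool ((Min (fst ` X), True) \<in> X))" for X
  have fin: "finite X" if "X \<in> sign_vectors n" for X
    using that finite_imageD finite_subset[of "fst ` X" "{..<n}"] by (auto simp: sign_vectors_def)
  have part_sub: "part b X \<subseteq> {..<n}" if "X \<in> sign_vectors n" for X b
    using that by (force simp: sign_vectors_def part_def)
  have inj: "(i, True) \<in> X \<Longrightarrow> (i, False) \<notin> X" if "X \<in> sign_vectors n" for X i
    using that inj_onD[of fst X "(i, True)" "(i, False)"] by (auto simp: sign_vectors_def)
  have part_disj: "part True X \<inter> part False X = {}" if "X \<in> sign_vectors n" for X
    using inj[OF that] by (auto simp: part_def)
  have card_part: "card X = card (part True X) + card (part False X)" if "X \<in> sign_vectors n" for X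
  proof -
    have "fst ` X = {i. \<exists>b. (i, b) \<in> X}"
      by force
    also have "\<dots> = part True X \<union> part False X"
      by (auto simp: part_def ex_bool_eq)
    finally have fst_X: "fst ` X = part True X \<union> part False X" .
    have "card X = card (fst ` X)"
      using that by (simp add: sign_vectors_def card_image)
    also have "\<dots> = card (part True X) + card (part False X)"
      unfolding fst_X using part_disj[OF that] finite_subset[OF part_sub[OF that]]
      by (intro card_Un_disjoint) auto
    finally show ?thesis .
  qed
  have neq: "c U \<noteq> c V" if "U \<subseteq> {..<n}" "V \<subseteq> {..<n}" "U \<inter> V = {}" "n < card U + card V + k" for U V
    using none that by blast
  have top_neq: "c (part True X) \<noteq> c (part False X)" if "X \<in> sign_vectors n" "top X" for X
    using that part_sub part_disj card_part by (intro neq) (auto simp: top_def)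
  have flip_mem: "(i, b) \<in> apsnd Not ` X \<longleftrightarrow> (i, \<not> b) \<in> X" for i b and X :: "(nat \<times> bool) set"
    by force
  have "\<exists>X\<in>sign_vectors n. \<exists>Y\<in>sign_vectors n. X \<subseteq> Y \<and> l Y = opp (l X)"
  proof (rule octahedral_tucker)
    fix X assume X: "X \<in> sign_vectors n"
    have card_flip: "card (apsnd Not ` X) = card X"
      by (rule card_image) (auto simp: inj_on_def)
    have fst_flip: "fst ` apsnd Not ` X = fst ` X"
      by (simp add: image_image)
    have part_flip: "part b (apsnd Not ` X) = part (\<not> b) X" for b
      by (simp add: part_def flip_mem)
    have top_flip: "top (apsnd Not ` X) \<longleftrightarrow> top X"
      by (simp add: top_def card_flip)
    have "Min (fst ` X) \<in> fst ` X"
      using X fin by (intro Min_in) (auto simp: sign_vectors_def)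
    then obtain b where "(Min (fst ` X), b) \<in> X"
      by force
    then have min_sign: "(Min (fst ` X), False) \<in> X \<longleftrightarrow> (Min (fst ` X), True) \<notin> X"
      using inj[OF X, of "Min (fst ` X)"] by (cases b) auto
    show "l (apsnd Not ` X) = opp (l X)"
    proof (cases "top X")
      case True
      then show ?thesis
        using top_neq[OF X True] unfolding l_def top_flip part_flip
        by (cases "c (part True X) < c (part False X)") (simp_all add: opp_def min_def)
    next
      case False
      then show ?thesis
        using min_sign unfolding l_def top_flip card_flip fst_flip flip_mem
        by (simp add: opp_def)
    qed
    show "l X div 2 < n - 1"
    proof (cases "top X")
      case True
      then have "min (c (part True X)) (c (part False X)) < k - 1"
        using top_neq[OF X True] colours[of "part True X"] colours[of "part False X"] by linarith
      then show ?thesis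
        using True \<open>k \<le> n\<close> by (simp add: l_def)
    next
      case False
      have "card X \<noteq> 0"
        using fin[OF X] X by (auto simp: sign_vectors_def)
      then show ?thesis
        using False \<open>0 < k\<close> \<open>k \<le> n\<close> by (auto simp: l_def top_def)
    qed
  qed (use \<open>0 < k\<close> \<open>k \<le> n\<close> in auto)
  then obtain X Y where X: "X \<in> sign_vectors n" and Y: "Y \<in> sign_vectors n" 
    and "X \<subseteq> Y" and eq: "l Y = opp (l X)"
    by blast
  have le: "card X \<le> card Y"
    using card_mono[OF fin[OF Y] \<open>X \<subseteq> Y\<close>] .
  have part_mono: "part b X \<subseteq> part b Y" for b
    using \<open>X \<subseteq> Y\<close> by (auto simp: part_def)
  have fin_part: "finite (part b Y)" for b
    using part_sub[OF Y] finite_subset by blast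
  have div: "l Y div 2 = l X div 2" and odd: "odd (l Y) \<longleftrightarrow> even (l X)"
    unfolding eq by (auto simp: opp_def elim!: oddE)
  have pos: "card X \<noteq> 0"
    using fin[OF X] X by (auto simp: sign_vectors_def)
  consider "top X" "top Y" | "\<not> top X" "top Y" | "\<not> top X" "\<not> top Y"
    using le by (auto simp: top_def)
  then show False
  proof cases
    case 1
    have card_le: "n < card (part b X) + card (part (\<not> b) Y) + k" for b
    proof -
      have "card (part (\<not> b) X) \<le> card (part (\<not> b) Y)"
        by (rule card_mono[OF fin_part part_mono])
      then show ?thesis
        using 1(1) card_part[OF X] by (cases b) (auto simp: top_def)
    qed
    have "c (part b X) \<noteq> c (part (\<not> b) Y)" for b
    proof (rule neq)
      show "part b X \<inter> part (\<not> b) Y = {}"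
        using part_disj[OF Y] part_mono[of b] by (cases b) auto
    qed (use part_sub X Y card_le in auto)
    from this[of True] this[of False] show False
      using div odd 1 top_neq[OF X 1(1)] top_neq[OF Y 1(2)]
      by (auto simp: l_def min_def split: if_splits)
  next
    case 2
    then show False
      using div pos by (simp add: l_def top_def)
  next
    case 3
    then have "card X = card Y"
      using div pos le by (simp add: l_def)
    then have "X = Y"
      using card_subset_eq[OF fin[OF Y] \<open>X \<subseteq> Y\<close>] by simp
    then show False
      using odd by simp
  qed
qed

section \<open>Balanced sets are rare\<close>

text \<open>
  The weights \<open>w\<close> with \<open>\<bar>2 * w - n\<bar> \<le> 2 * r + 1\<close>.  The margin is more than \<open>2 * r\<close>, so that complementing a
  set up to \<open>r\<close> elements moves a weight outside the window to the other side of \<open>n / 2\<close>; the summand \<open>1\<close>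
  puts \<open>n div 2\<close> into the window also for odd \<open>n\<close> and \<open>r = 0\<close>.
\<close>
definition window :: "nat \<Rightarrow> nat \<Rightarrow> nat set" where
  "window r n = {w. n \<le> 2 * w + 2 * r + 1 \<and> 2 * w \<le> n + 2 * r + 1}"

lemma card_window: "finite (window r n)" "card (window r n) \<le> 2 * r + 2"
proof -
  define a where "a = (n - (2 * r + 1) + 1) div 2"
  have "window r n \<subseteq> {a..<a + (2 * r + 2)}"
    unfolding window_def a_def by auto
  then show "finite (window r n)" "card (window r n) \<le> 2 * r + 2"
    using card_mono[of "{a..<a + (2 * r + 2)}"] finite_subset by auto
qed

lemma card_window_subsets:
  assumes "finite B"
  shows "card {W. W \<subseteq> B \<and> card W \<in> window r (card B)} \<le> (2 * r + 2) * (card B choose (card B div 2))"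
proof -
  have "{W. W \<subseteq> B \<and> card W \<in> window r (card B)} = (\<Union>w\<in>window r (card B). {W. W \<subseteq> B \<and> card W = w})"
    by auto
  also have "card \<dots> \<le> (\<Sum>w\<in>window r (card B). card {W. W \<subseteq> B \<and> card W = w})"
    by (rule card_UN_le[OF card_window(1)])
  also have "\<dots> = (\<Sum>w\<in>window r (card B). card B choose w)"
    using assms by (simp add: n_subsets)
  also have "\<dots> \<le> card (window r (card B)) * (card B choose (card B div 2))"
    using sum_bounded_above[of "window r (card B)" "\<lambda>w. card B choose w" "card B choose (card B div 2)"]
    by (simp add: binomial_maximum)
  also have "\<dots> \<le> (2 * r + 2) * (card B choose (card B div 2))"
    by (rule mult_right_mono[OF card_window(2)]) simp
  finally show ?thesis .
qed

text \<open>
  The ratio of consecutive central binomial coefficients is \<open>2 * (2 * k + 1) / (k + 1)\<close>, and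
  \<open>(2 * k + 1) * (2 * k + 3) \<le> 4 * (k + 1)\<^sup>2\<close>.
\<close>
lemma central_binomial_square_le: "(2 * k + 1) * (2 * k choose k)\<^sup>2 \<le> 16 ^ k"
proof (induction k)
  case (Suc k)
  define b where "b = 2 * k choose k"
  define b' where "b' = 2 * Suc k choose Suc k"
  have "Suc (2 * k + 1) * (Suc (2 * k) choose k) = (2 * Suc k choose Suc k) * Suc k"
    using Suc_times_binomial_eq[of "2 * k + 1" k] by simp
  moreover have "(Suc (2 * k) choose k) * Suc k = (2 * k + 1) * b"
    using Suc_times_binomial_eq[of "2 * k" k] binomial_symmetric[of k "Suc (2 * k)"]
    by (simp add: b_def Suc_diff_le mult_2)
  ultimately have step: "(k + 1) * b' = 2 * (2 * k + 1) * b"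
    by (simp add: b'_def algebra_simps)
  have "(k + 1)\<^sup>2 * ((2 * k + 3) * b'\<^sup>2) = (2 * k + 3) * ((k + 1) * b')\<^sup>2"
    by (simp add: power2_eq_square algebra_simps)
  also have "\<dots> = 4 * ((2 * k + 3) * (2 * k + 1)) * ((2 * k + 1) * b\<^sup>2)"
    unfolding step by (simp add: power2_eq_square algebra_simps)
  also have "\<dots> \<le> 4 * (4 * (k + 1)\<^sup>2) * 16 ^ k"
  proof (rule mult_le_mono)
    show "4 * ((2 * k + 3) * (2 * k + 1)) \<le> 4 * (4 * (k + 1)\<^sup>2)"
      by (simp add: power2_eq_square algebra_simps)
  qed (use Suc.IH in \<open>simp add: b_def\<close>)
  also have "\<dots> = (k + 1)\<^sup>2 * 16 ^ Suc k"
    by simp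
  finally have "(2 * k + 3) * b'\<^sup>2 \<le> 16 ^ Suc k"
    by simp
  then show ?case
    by (simp add: b'_def algebra_simps)
qed simp

lemma central_binomial_small:
  fixes \<delta> :: real
  assumes "\<delta> > 0"
  shows "\<exists>k\<ge>K. (2 * r + 2) * real (2 * k choose k) \<le> \<delta> * 2 ^ (2 * k)"
proof -
  obtain k where k: "((2 * r + 2) / \<delta>)\<^sup>2 \<le> real k" "K \<le> k"
    using real_arch_simple[of "max (real K) (((2 * r + 2) / \<delta>)\<^sup>2)"] by auto
  have "((2 * r + 2) * real (2 * k choose k))\<^sup>2 = \<delta>\<^sup>2 * (((2 * r + 2) / \<delta>)\<^sup>2 * (real (2 * k choose k))\<^sup>2)"
    using assms by (simp add: power_mult_distrib power_divide)
  also have "\<dots> \<le> \<delta>\<^sup>2 * ((2 * k + 1) * (real (2 * k choose k))\<^sup>2)"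
    using k by (intro mult_left_mono mult_right_mono) auto
  also have "\<dots> \<le> \<delta>\<^sup>2 * 16 ^ k"
  proof (rule mult_left_mono)
    have "real ((2 * k + 1) * (2 * k choose k)\<^sup>2) \<le> real (16 ^ k)"
      unfolding of_nat_le_iff by (rule central_binomial_square_le)
    then show "(2 * k + 1) * (real (2 * k choose k))\<^sup>2 \<le> 16 ^ k"
      by (simp add: algebra_simps)
  qed simp
  also have "\<dots> = (\<delta> * 2 ^ (2 * k))\<^sup>2"
  proof -
    have "(2::real) ^ (2 * k) = 4 ^ k"
      by (simp add: power_mult)
    moreover have "((4::real) ^ k)\<^sup>2 = 16 ^ k"
      by (simp flip: power_mult power_mult_distrib add: power2_eq_square)
    ultimately show ?thesis
      by (simp add: power_mult_distrib)
  qed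
  finally have "(2 * r + 2) * real (2 * k choose k) \<le> \<delta> * 2 ^ (2 * k)"
    by (rule power2_le_imp_le) (use assms in simp)
  then show ?thesis using k(2) by blast
qed

section \<open>Vectors over the two-element field\<close>

abbreviation supp :: "F2_omega \<Rightarrow> nat set" where
  "supp \<equiv> Poly_Mapping.keys"

lemma add_self_F2 [simp]: "x + x = (0 :: F2_omega)"
  by (rule poly_mapping_eqI) (simp only: lookup_add add_bit_eq_xor, simp)

lemma add_add_self_F2 [simp]: "x + (x + y) = (y :: F2_omega)"
  by (simp only: add.assoc[symmetric] add_self_F2 add_0_left)

lemma minus_F2: "x - y = x + (y :: F2_omega)"
  using minus_unique[OF add_self_F2[of y]] by (simp only: diff_conv_add_uminus)

lemma supp_add: "supp (x + y :: F2_omega) = sym_diff (supp x) (supp y)"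
  by (auto simp: in_keys_iff lookup_add)

lemma supp_inject: "supp x = supp y \<Longrightarrow> x = (y :: F2_omega)"
proof (rule poly_mapping_eqI)
  fix k assume "supp x = supp y"
  then show "Poly_Mapping.lookup x k = Poly_Mapping.lookup y k"
    using in_keys_iff[of k x] in_keys_iff[of k y] by (cases "k \<in> supp x") simp_all
qed

definition vec_of :: "nat set \<Rightarrow> F2_omega" where
  "vec_of U = Abs_poly_mapping (\<lambda>i. of_bool (i \<in> U))"

lemma supp_vec_of [simp]: "finite U \<Longrightarrow> supp (vec_of U) = U"
  by (auto simp: vec_of_def in_keys_iff Abs_poly_mapping_inverse)

definition below :: "nat \<Rightarrow> F2_omega set" where
  "below M = {x. supp x \<subseteq> {..<M}}"

lemma bij_betw_supp_below: "bij_betw supp (below M) (Pow {..<M})"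
  unfolding bij_betw_def
proof
  show "inj_on supp (below M)"
    by (auto intro: inj_onI supp_inject)
  show "supp ` below M = Pow {..<M}"
  proof
    show "Pow {..<M} \<subseteq> supp ` below M"
    proof
      fix U assume "U \<in> Pow {..<M}"
      then have "supp (vec_of U) = U"
        by (intro supp_vec_of) (auto intro: finite_subset)
      then show "U \<in> supp ` below M"
        using \<open>U \<in> Pow {..<M}\<close> unfolding below_def by (metis (mono_tags) PowD imageI mem_Collect_eq)
    qed
  qed (auto simp: below_def)
qed

lemma finite_below: "finite (below M)"
  using bij_betw_finite[OF bij_betw_supp_below] by simp

lemma card_below: "card (below M) = 2 ^ M"
  using bij_betw_same_card[OF bij_betw_supp_below] by (simp add: card_Pow)

lemma zero_below: "0 \<in> below M"
  by (simp add: below_def)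

lemma add_below: "x \<in> below M \<Longrightarrow> y \<in> below M \<Longrightarrow> x + y \<in> below M"
  by (auto simp: below_def supp_add)

lemma below_mono: "M \<le> M' \<Longrightarrow> below M \<subseteq> below M'"
  by (auto simp: below_def)

lemma ex_below: "\<exists>M. x \<in> below M"
proof
  show "x \<in> below (Suc (Max (insert 0 (supp x))))"
    by (auto simp: below_def less_Suc_eq_le)
qed

text \<open>
  An increasing sequence of finite subgroups with union \<open>\<bbbF>\<^sub>2\<^sup>\<omega>\<close> is a Folner sequence, since each vector
  eventually translates them to themselves.
\<close>
lemma folner_below:
  assumes "strict_mono p"
  shows "folner_seq (\<lambda>N. below (p N))"
  unfolding folner_seq_def
proof (intro conjI allI)
  fix N show "finite (below (p N))" "below (p N) \<noteq> {}"
    using finite_below zero_below by auto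
next
  fix g :: F2_omega
  obtain M where M: "g \<in> below M"
    using ex_below by blast
  have "(g +o below (p N)) \<inter> below (p N) = below (p N)" if "M \<le> N" for N
  proof -
    have g: "g \<in> below (p N)"
      using M that seq_suble[OF assms, of N] below_mono[of M "p N"] by auto
    have "x \<in> g +o below (p N)" if "x \<in> below (p N)" for x
      using add_below[OF g that] by (auto simp: elt_set_plus_def intro!: bexI[of _ "g + x"])
    then show ?thesis by blast
  qed
  then have "real (card ((g +o below (p N)) \<inter> below (p N))) / real (card (below (p N))) = 1" if "M \<le> N" for N
    using that by (simp add: card_below)
  then show "(\<lambda>N. real (card ((g +o below (p N)) \<inter> below (p N))) / real (card (below (p N)))) \<longlonglongrightarrow> 1"
    by (intro tendsto_eventually) (auto simp: eventually_sequentially)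
qed

lemma upper_banach_density_ge:
  assumes "folner_seq \<Phi>" "\<And>N. c \<le> real (card (A \<inter> \<Phi> N)) / real (card (\<Phi> N))"
  shows "ereal c \<le> upper_banach_density A"
proof -
  have "ereal c \<le> limsup (\<lambda>n. ereal (real (card (A \<inter> \<Phi> n)) / real (card (\<Phi> n))))"
    using assms(2) by (intro le_Limsup) auto
  also have "\<dots> \<le> upper_banach_density A"
    unfolding upper_banach_density_def by (rule SUP_upper) (use assms(1) in simp)
  finally show ?thesis .
qed

section \<open>Blocks and the untwisting map\<close>

text \<open>
  Block \<open>m\<close> starts at coordinate \<open>p m\<close> and has radius \<open>r m\<close>.  It is long enough for \<open>0\<close> to have a
  weight outside the window around half of the block.
\<close>
locale twisted_blocks =
  fixes p r :: "nat \<Rightarrow> nat" and t :: "nat \<Rightarrow> F2_omega"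
  assumes p_Suc: "p m + 2 * r m + 1 < p (Suc m)"
    and t_below: "t m \<in> below (p m)"
begin

definition block :: "nat \<Rightarrow> nat set" where
  "block m = {p m..<p (Suc m)}"

definition mid :: "nat \<Rightarrow> F2_omega \<Rightarrow> bool" where
  "mid m x \<longleftrightarrow> card (supp x \<inter> block m) \<in> window (r m) (card (block m))"

definition heavy :: "nat \<Rightarrow> F2_omega \<Rightarrow> bool" where
  "heavy m x \<longleftrightarrow> card (block m) < 2 * card (supp x \<inter> block m)"

definition twist :: "nat \<Rightarrow> F2_omega \<Rightarrow> F2_omega" where
  "twist m x = (if heavy m x then x + t m else x)"

text \<open>
  The blocks are treated from the top down.  As \<open>t m\<close> vanishes on block \<open>m\<close> and above, the twist at
  block \<open>m\<close> changes neither the heaviness it depends on nor any block that has already been treated.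
\<close>
primrec untwist :: "nat \<Rightarrow> F2_omega \<Rightarrow> F2_omega" where
  "untwist 0 x = x"
| "untwist (Suc N) x = untwist N (twist N x)"

lemma strict_mono_p: "strict_mono p"
  unfolding strict_mono_Suc_iff using p_Suc add_lessD1 by blast

lemma p_mono: "i \<le> j \<Longrightarrow> p i \<le> p j"
  using strict_mono_p by (simp add: strict_mono_less_eq)

lemma finite_block [simp]: "finite (block m)"
  by (simp add: block_def)

lemma card_block_gt: "2 * r m + 1 < card (block m)"
  using p_Suc[of m] by (simp add: block_def)

lemma block_disjoint: "i \<noteq> j \<Longrightarrow> block i \<inter> block j = {}"
  using p_mono[of "Suc i" j] p_mono[of "Suc j" i] by (cases "i < j") (auto simp: block_def)

lemma below_disjoint_block: "x \<in> below (p N) \<Longrightarrow> N \<le> i \<Longrightarrow> supp x \<inter> block i = {}"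
  using p_mono[of N i] by (fastforce simp: below_def block_def)

lemma block_below: "supp x \<subseteq> block i \<Longrightarrow> i < N \<Longrightarrow> x \<in> below (p N)"
  using p_mono[of "Suc i" N] by (fastforce simp: below_def block_def)

lemma below_p_mono: "x \<in> below (p i) \<Longrightarrow> i \<le> j \<Longrightarrow> x \<in> below (p j)"
  using below_mono[OF p_mono] by blast

lemma ex_below_p: "\<exists>N. x \<in> below (p N)"
proof -
  obtain M where "x \<in> below M"
    using ex_below by blast
  then have "x \<in> below (p M)"
    using below_mono[OF seq_suble[OF strict_mono_p, of M]] by blast
  then show ?thesis ..
qed

lemma mid_cong: "supp x \<inter> block m = supp y \<inter> block m \<Longrightarrow> mid m x \<longleftrightarrow> mid m y"
  by (simp add: mid_def)

lemma heavy_cong: "supp x \<inter> block m = supp y \<inter> block m \<Longrightarrow> heavy m x \<longleftrightarrow> heavy m y"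
  by (simp add: heavy_def)

lemma not_mid_if_disjoint: "supp x \<inter> block m = {} \<Longrightarrow> \<not> mid m x"
  using card_block_gt[of m] by (simp add: mid_def window_def)

lemma block_add_disjoint: "supp s \<inter> block m = {} \<Longrightarrow> supp (x + s) \<inter> block m = supp x \<inter> block m"
  by (auto simp: supp_add)

lemma block_twist: "m \<le> i \<Longrightarrow> supp (twist m x) \<inter> block i = supp x \<inter> block i"
  using block_add_disjoint[OF below_disjoint_block[OF t_below]] by (simp add: twist_def)

lemma block_untwist: "N \<le> Suc i \<Longrightarrow> supp (untwist N x) \<inter> block i = supp x \<inter> block i"
  by (induction N arbitrary: x) (auto simp: block_twist)

lemma twist_add: "supp s \<inter> block m = {} \<Longrightarrow> twist m (x + s) = twist m x + s"
  using heavy_cong[OF block_add_disjoint, of s m x] by (simp add: twist_def ac_simps)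

lemma untwist_add: "(\<And>i. i < N \<Longrightarrow> supp s \<inter> block i = {}) \<Longrightarrow> untwist N (x + s) = untwist N x + s"
  by (induction N arbitrary: x) (auto simp: twist_add)

lemma twist_twist: "twist m (twist m x) = x"
proof -
  have "heavy m (twist m x) \<longleftrightarrow> heavy m x"
    by (rule heavy_cong) (rule block_twist, simp)
  then show ?thesis
    by (simp add: twist_def add.assoc)
qed

lemma untwist_below: "x \<in> below (p M) \<Longrightarrow> N \<le> M \<Longrightarrow> untwist N x \<in> below (p M)"
proof (induction N arbitrary: x)
  case (Suc N)
  have "t N \<in> below (p M)"
    using t_below below_mono[OF p_mono] Suc.prems(2) Suc_leD by blast
  then have "twist N x \<in> below (p M)"
    using Suc.prems add_below by (simp add: twist_def)
  then show ?case
    using Suc by simp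
qed simp

lemma inj_untwist: "inj (untwist N)"
proof (induction N)
  case (Suc N)
  have "inj (twist N)"
    by (metis injI twist_twist)
  then have "inj (untwist N \<circ> twist N)"
    using Suc by (simp add: inj_compose)
  moreover have "untwist (Suc N) = untwist N \<circ> twist N"
    by auto
  ultimately show ?case by metis
qed simp

lemma untwist_image: "untwist N ` below (p N) = below (p N)"
  using untwist_below inj_on_subset[OF inj_untwist subset_UNIV]
  by (intro endo_inj_surj finite_below) auto

lemma untwist_stable:
  assumes "x \<in> below (p N)" "N \<le> M"
  shows "untwist M x = untwist N x"
  using assms(2)
proof (induction M rule: dec_induct)
  case (step M)
  have "\<not> heavy M x"
    using below_disjoint_block[OF assms(1) step.hyps(1)] by (simp add: heavy_def)
  then show ?case
    using step.IH by (simp add: twist_def)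
qed simp

text \<open>
  Blocks beyond the support are not heavy, so the number of blocks treated does not matter as soon as
  they cover the support.
\<close>
definition normal :: "F2_omega \<Rightarrow> F2_omega" where
  "normal x = untwist (LEAST N. x \<in> below (p N)) x"

lemma normal_eq: "x \<in> below (p N) \<Longrightarrow> normal x = untwist N x"
  unfolding normal_def by (metis (mono_tags) LeastI Least_le untwist_stable)

lemma heavy_add:
  assumes u: "supp u \<subseteq> block m" "card (block m) \<le> card (supp u) + r m" and "\<not> mid m x"
  shows "heavy m (x + u) \<longleftrightarrow> \<not> heavy m x"
proof -
  define X where "X = supp x \<inter> block m"
  define U where "U = supp u"
  have fin: "finite X" "finite U"
    by (auto simp: X_def U_def)
  have sub: "X \<subseteq> block m" "U \<subseteq> block m"
    using u by (auto simp: X_def U_def)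
  have "supp (x + u) \<inter> block m = sym_diff X U"
    using u(1) by (auto simp: X_def U_def supp_add)
  moreover have "card (sym_diff X U) = card (X - U) + card (U - X)"
    using fin by (intro card_Un_disjoint) auto
  moreover have "card X = card (X - U) + card (X \<inter> U)" "card U = card (U - X) + card (X \<inter> U)"
    using fin by (metis add.commute card_Diff_subset_Int card_mono finite_Int inf_commute inf_le1 le_add_diff_inverse)+
  moreover have "card (X - U) + card U \<le> card (block m)"
  proof -
    have "card ((X - U) \<union> U) \<le> card (block m)"
      using sub by (intro card_mono) auto
    moreover have "card ((X - U) \<union> U) = card (X - U) + card U"
      using fin by (intro card_Un_disjoint) auto
    ultimately show ?thesis
      by linarith
  qed
  ultimately show ?thesis
    using u(2) \<open>\<not> mid m x\<close> unfolding heavy_def mid_def window_def X_def[symmetric] U_def[symmetric]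
    by auto
qed

text \<open>
  The blocks above \<open>m\<close> do not notice \<open>t m + u\<close>.  At block \<open>m\<close>, adding \<open>u\<close> toggles the heaviness, so
  exactly one of the two vectors is twisted by a second \<open>t m\<close>, which cancels the first.  The blocks
  below \<open>m\<close> do not notice \<open>u\<close>.
\<close>
lemma untwist_jump:
  assumes u: "supp u \<subseteq> block m" "card (block m) \<le> card (supp u) + r m"
    and "Suc m \<le> N" "\<not> mid m (untwist N x)"
  shows "untwist N (x + (t m + u)) = untwist N x + u"
  using assms(3,4)
proof (induction N arbitrary: x rule: dec_induct)
  case base
  have disj: "supp u \<inter> block i = {}" if "i < m" for i
    using u(1) block_disjoint[of m i] that by auto
  have t_disj: "supp (t m) \<inter> block m = {}"
    by (rule below_disjoint_block[OF t_below]) simp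
  have "\<not> mid m x"
    using base mid_cong[OF block_untwist[OF order_refl, of m x]] by simp
  then have "heavy m (x + u) \<longleftrightarrow> \<not> heavy m x"
    by (rule heavy_add[OF u])
  then have flip: "twist m (x + u) = twist m x + u + t m"
    by (auto simp: twist_def ac_simps)
  have "twist m (x + (t m + u)) = twist m (x + u) + t m"
    using twist_add[OF t_disj, of "x + u"] by (simp add: ac_simps)
  also have "\<dots> = twist m x + u"
    unfolding flip by (simp add: add.assoc)
  finally show ?case
    by (simp add: untwist_add disj)
next
  case (step N)
  have "t m + u \<in> below (p N)"
    using block_below[OF u(1)] t_below below_mono[OF p_mono, of m N] step.hyps(1)
    by (intro add_below) auto
  then have "twist N (x + (t m + u)) = twist N x + (t m + u)"
    by (intro twist_add below_disjoint_block) auto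
  then show ?case
    using step.IH step.prems by simp
qed

lemma ex_mid: "\<exists>u. supp u \<subseteq> block m \<and> mid m (x + u)"
proof -
  obtain C where C: "C \<subseteq> block m" "card C = card (block m) div 2"
    using obtain_subset_with_card_n[OF div_le_dividend, of "block m" 2] by metis
  define U where "U = sym_diff (supp x \<inter> block m) C"
  have "finite U" "U \<subseteq> block m"
    using C(1) by (auto simp: U_def intro: finite_subset)
  moreover have "supp (x + vec_of U) \<inter> block m = C"
    using \<open>finite U\<close> C(1) by (auto simp: supp_add U_def)
  moreover have "card C \<in> window (r m) (card (block m))"
    unfolding C(2) window_def by auto
  ultimately show ?thesis
    by (intro exI[of _ "vec_of U"]) (auto simp: mid_def)
qed

section \<open>Avoiding the sumset by finitely many translations\<close>

text \<open>
  After the blocks above \<open>Suc J\<close> have been treated, block \<open>Suc J\<close> is final, and it can be made \<open>mid\<close>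
  by a vector supported on it.  The twist at \<open>Suc J\<close> is then determined, and a vector
  supported on block \<open>J\<close> does the same there.  The further summand \<open>v\<close> lies below both blocks, so it
  influences neither of them; hence one \<open>w\<close> works for all \<open>v\<close>.
\<close>
lemma ex_two_mid:
  assumes "J + 2 \<le> N"
  shows "\<exists>w\<in>below (p (J + 2)). \<forall>v\<in>below (p J).
           mid J (untwist N (g + w + v)) \<and> mid (Suc J) (untwist N (g + w + v))"
  using assms
proof (induction N arbitrary: g rule: dec_induct)
  case base
  obtain w1 where w1: "supp w1 \<subseteq> block (Suc J)" "mid (Suc J) (g + w1)"
    using ex_mid by blast
  define y where "y = twist (Suc J) (g + w1)"
  obtain w0 where w0: "supp w0 \<subseteq> block J" "mid J (y + w0)"
    using ex_mid by blast
  have w: "w1 + w0 \<in> below (p (J + 2))"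
    using block_below[OF w1(1)] block_below[OF w0(1)] by (intro add_below) auto
  have "mid J (untwist (J + 2) (g + (w1 + w0) + v)) \<and> mid (Suc J) (untwist (J + 2) (g + (w1 + w0) + v))"
    if v: "v \<in> below (p J)" for v
  proof -
    have "w0 + v \<in> below (p (Suc J))"
      using block_below[OF w0(1)] v below_mono[OF p_mono, of J "Suc J"] by (intro add_below) auto
    then have disj: "supp (w0 + v) \<inter> block (Suc J) = {}"
      by (rule below_disjoint_block) simp
    have x: "g + (w1 + w0) + v = g + w1 + (w0 + v)"
      by (simp add: ac_simps)
    have "mid (Suc J) (untwist (J + 2) (g + (w1 + w0) + v)) \<longleftrightarrow> mid (Suc J) (g + w1 + (w0 + v))"
      unfolding x by (intro mid_cong block_untwist) simp
    also have "\<dots> \<longleftrightarrow> mid (Suc J) (g + w1)"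
      by (intro mid_cong block_add_disjoint disj)
    finally have "mid (Suc J) (untwist (J + 2) (g + (w1 + w0) + v))"
      using w1(2) by simp
    moreover have "mid J (untwist (J + 2) (g + (w1 + w0) + v)) \<longleftrightarrow> mid J (untwist (Suc J) (y + w0 + v))"
      unfolding x using twist_add[OF disj, of "g + w1"] by (simp add: y_def add.assoc)
    moreover have "\<dots> \<longleftrightarrow> mid J (y + w0 + v)"
      by (intro mid_cong block_untwist) simp
    moreover have "\<dots> \<longleftrightarrow> mid J (y + w0)"
      by (intro mid_cong block_add_disjoint below_disjoint_block[OF v]) simp
    ultimately show ?thesis
      using w0(2) by blast
  qed
  then show ?case
    using w by blast
next
  case (step N)
  obtain w where w: "w \<in> below (p (J + 2))" and mid: "\<forall>v\<in>below (p J).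
           mid J (untwist N (twist N g + w + v)) \<and> mid (Suc J) (untwist N (twist N g + w + v))"
    using step.IH by blast
  have "untwist (Suc N) (g + w + v) = untwist N (twist N g + w + v)" if "v \<in> below (p J)" for v
  proof -
    have "w + v \<in> below (p (J + 2))"
      using w that below_mono[OF p_mono, of J "J + 2"] by (intro add_below) auto
    then have "twist N (g + (w + v)) = twist N g + (w + v)"
      by (intro twist_add below_disjoint_block[OF _ step.hyps(1)])
    then show ?thesis
      by (simp add: add.assoc)
  qed
  then show ?case
    using w mid by (intro bexI[of _ w]) simp_all
qed

definition jumps :: "F2_omega set" where
  "jumps = {t m + u | m u. supp u \<subseteq> block m \<and> card (block m) \<le> card (supp u) + r m}"

definition unbalanced :: "F2_omega set" where
  "unbalanced = {x. \<forall>i. \<not> mid i (normal x)}"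

text \<open>
  In the coordinates given by \<open>normal\<close>, adding an element of \<open>jumps\<close> to an element of \<open>unbalanced\<close>
  changes only one block.
\<close>
lemma jumps_plus_unbalanced:
  assumes "x \<in> jumps + unbalanced"
  shows "\<exists>m. \<forall>i. i \<noteq> m \<longrightarrow> \<not> mid i (normal x)"
proof -
  obtain m u a where x: "x = a + (t m + u)" 
    and u: "supp u \<subseteq> block m" "card (block m) \<le> card (supp u) + r m"
    and a: "\<And>i. \<not> mid i (normal a)"
    using assms by (auto simp: jumps_def unbalanced_def set_plus_def add.commute)
  obtain M where M: "a \<in> below (p M)"
    using ex_below_p by blast
  define N where "N = max M (Suc m)"
  have aN: "a \<in> below (p N)"
    using M below_mono[OF p_mono, of M N] by (auto simp: N_def)
  have "t m + u \<in> below (p N)"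
    using block_below[OF u(1)] below_p_mono[OF t_below] by (intro add_below) (auto simp: N_def)
  then have "normal x = untwist N (a + (t m + u))"
    unfolding x by (intro normal_eq add_below[OF aN])
  also have "\<dots> = normal a + u"
    unfolding normal_eq[OF aN]
  proof (rule untwist_jump[OF u])
    show "\<not> mid m (untwist N a)"
      using a[of m] by (simp add: normal_eq[OF aN])
  qed (simp add: N_def)
  finally have normal: "normal x = normal a + u" .
  have "\<not> mid i (normal x)" if "i \<noteq> m" for i
  proof -
    have "supp u \<inter> block i = {}"
      using u(1) block_disjoint[OF that] by auto
    then have "mid i (normal x) \<longleftrightarrow> mid i (normal a)"
      unfolding normal by (intro mid_cong block_add_disjoint)
    then show ?thesis
      using a by simp
  qed
  then show ?thesis
    by blast
qed

lemma ex_translate_avoiding: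
  "\<exists>w\<in>below (p (J + 2)). \<forall>v\<in>below (p J). g + w + v \<notin> jumps + unbalanced"
proof -
  obtain M where M: "g \<in> below (p M)"
    using ex_below_p by blast
  define N where "N = max M (J + 2)"
  obtain w where w: "w \<in> below (p (J + 2))" and mid: "\<And>v. v \<in> below (p J) \<Longrightarrow>
       mid J (untwist N (g + w + v)) \<and> mid (Suc J) (untwist N (g + w + v))"
    using ex_two_mid[of J N g] by (auto simp: N_def)
  have "g + w + v \<notin> jumps + unbalanced" if v: "v \<in> below (p J)" for v
  proof
    have "g + w + v \<in> below (p N)"
      using below_p_mono[OF M, of N] below_p_mono[OF w, of N] below_p_mono[OF v, of N]
      by (intro add_below) (auto simp: N_def)
    then have "mid J (normal (g + w + v))" "mid (Suc J) (normal (g + w + v))"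
      using mid[OF v] by (simp_all add: normal_eq)
    moreover assume "g + w + v \<in> jumps + unbalanced"
    ultimately show False
      using jumps_plus_unbalanced n_not_Suc_n by metis
  qed
  then show ?thesis
    using w by blast
qed

text \<open>
  Let finitely many translates of \<open>B\<close>, by vectors in \<open>below (p J)\<close>, cover the group.  The finite part
  of \<open>B\<close> in the subgroup \<open>below (p (J + 2))\<close> cannot be translated by any \<open>g\<close> into the sumset: for the
  \<open>w\<close> of \<open>ex_translate_avoiding\<close> write \<open>w = v + b\<close> with \<open>v \<in> below (p J)\<close> and \<open>b \<in> B\<close>; then
  \<open>g + b = g + w + v\<close> is outside.
\<close>
lemma not_piecewise_syndetic: "\<not> piecewise_syndetic (jumps + unbalanced)"
proof
  assume "piecewise_syndetic (jumps + unbalanced)"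
  then obtain B T where T: "finite T" "(\<Union>t\<in>T. t +o B) = UNIV"
    and B: "\<And>F. finite F \<Longrightarrow> F \<subseteq> B \<Longrightarrow> \<exists>g. g +o F \<subseteq> jumps + unbalanced"
    by (auto simp: piecewise_syndetic_def syndetic_def)
  have "\<exists>J. T \<subseteq> below (p J)"
    using T(1)
  proof (induction T rule: finite_induct)
    case (insert x T)
    then obtain J K where "T \<subseteq> below (p J)" "x \<in> below (p K)"
      using ex_below_p by blast
    then have "insert x T \<subseteq> below (p (max J K))"
      using below_mono[OF p_mono, of J "max J K"] below_mono[OF p_mono, of K "max J K"] by auto
    then show ?case ..
  qed simp
  then obtain J where J: "T \<subseteq> below (p J)" ..
  define W where "W = below (p (J + 2))"
  have T_W: "T \<subseteq> W"
    using J below_mono[OF p_mono, of J "J + 2"] by (auto simp: W_def)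
  obtain g where g: "g +o (B \<inter> W) \<subseteq> jumps + unbalanced"
    using B[of "B \<inter> W"] finite_below by (auto simp: W_def)
  obtain w where w: "w \<in> W" and avoid: "\<And>v. v \<in> below (p J) \<Longrightarrow> g + w + v \<notin> jumps + unbalanced"
    using ex_translate_avoiding[of J g] by (auto simp: W_def)
  have "w \<in> (\<Union>t\<in>T. t +o B)"
    unfolding T(2) by simp
  then obtain v b where v: "v \<in> T" and b: "b \<in> B" "w = v + b"
    by (auto simp: elt_set_plus_def)
  have "b = w + v"
    unfolding b(2) by (simp add: ac_simps)
  then have "b \<in> B \<inter> W"
    using b(1) w v T_W add_below by (auto simp: W_def)
  then have "g + b \<in> jumps + unbalanced"
    using g by (auto simp: elt_set_plus_def)
  then show False
    using avoid[of v] v J \<open>b = w + v\<close> by (auto simp: add.assoc)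
qed

section \<open>Density and chromatic intersectivity\<close>

lemma card_mid_below:
  assumes "i < N"
  shows "card {x \<in> below (p N). mid i x} \<le>
           (2 * r i + 2) * (card (block i) choose (card (block i) div 2)) * 2 ^ (p N - card (block i))"
proof -
  define R where "R = {..<p N} - block i"
  define M where "M = {W. W \<subseteq> block i \<and> card W \<in> window (r i) (card (block i))}"
  have sub: "block i \<subseteq> {..<p N}"
    using p_mono[of "Suc i" N] assms by (auto simp: block_def)
  have fin: "finite M" "finite R"
    by (auto simp: M_def R_def)
  have "card {x \<in> below (p N). mid i x} \<le> card (M \<times> Pow R)"
  proof (rule card_inj_on_le)
    show "inj_on (\<lambda>x. (supp x \<inter> block i, supp x \<inter> R)) {x \<in> below (p N). mid i x}"
    proof (rule inj_onI)
      fix x y assume "x \<in> {x \<in> below (p N). mid i x}" "y \<in> {x \<in> below (p N). mid i x}"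
        "(supp x \<inter> block i, supp x \<inter> R) = (supp y \<inter> block i, supp y \<inter> R)"
      then have "supp x = supp y"
        by (auto simp: below_def R_def)
      then show "x = y"
        by (rule supp_inject)
    qed
  qed (use fin in \<open>auto simp: M_def mid_def\<close>)
  also have "\<dots> = card M * 2 ^ (p N - card (block i))"
    using fin sub by (simp add: card_cartesian_product card_Pow R_def card_Diff_subset)
  also have "\<dots> \<le> (2 * r i + 2) * (card (block i) choose (card (block i) div 2)) * 2 ^ (p N - card (block i))"
    using card_window_subsets[of "block i" "r i"] by (simp add: M_def)
  finally show ?thesis .
qed

text \<open>
  Untwisting permutes \<open>below (p N)\<close> and carries the elements of \<open>unbalanced\<close> there to the vectors that
  are \<open>mid\<close> on none of the first \<open>N\<close> blocks; the union bound over the blocks finishes the proof.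
\<close>
lemma unbalanced_density:
  fixes \<delta> :: "nat \<Rightarrow> real"
  assumes "\<And>i. (2 * r i + 2) * real (card (block i) choose (card (block i) div 2)) \<le> \<delta> i * 2 ^ card (block i)"
  shows "1 - (\<Sum>i<N. \<delta> i) \<le> real (card (unbalanced \<inter> below (p N))) / real (card (below (p N)))"
proof -
  define V where "V = below (p N)"
  have finV: "finite V"
    by (simp add: V_def finite_below)
  have mid_le: "real (card {x \<in> V. mid i x}) \<le> \<delta> i * 2 ^ p N" if "i < N" for i
  proof -
    have "card (block i) \<le> p N"
      using p_mono[of "Suc i" N] that by (simp add: block_def)
    have "real (card {x \<in> V. mid i x}) \<le>
        (2 * r i + 2) * real (card (block i) choose (card (block i) div 2)) * 2 ^ (p N - card (block i))"
      using of_nat_mono[OF card_mid_below[OF that], where ?'a = real]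
      by (simp add: V_def algebra_simps)
    also have "\<dots> \<le> \<delta> i * 2 ^ card (block i) * 2 ^ (p N - card (block i))"
      using assms[of i] by (intro mult_right_mono) auto
    also have "\<dots> = \<delta> i * 2 ^ p N"
      using \<open>card (block i) \<le> p N\<close> by (simp add: mult.assoc flip: power_add)
    finally show ?thesis .
  qed
  have "unbalanced \<inter> V = {x \<in> V. \<forall>i<N. \<not> mid i (untwist N x)}"
  proof -
    have "\<not> mid i (untwist N x)" if "x \<in> V" "N \<le> i" for x i
      using below_disjoint_block[OF untwist_below] that by (intro not_mid_if_disjoint) (auto simp: V_def)
    then have "(\<forall>i. \<not> mid i (normal x)) \<longleftrightarrow> (\<forall>i<N. \<not> mid i (untwist N x))" if "x \<in> V" for x
      using normal_eq[of x N] that not_le unfolding V_def by metis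
    then show ?thesis
      by (auto simp: unbalanced_def)
  qed
  then have "untwist N ` (unbalanced \<inter> V) = {y \<in> untwist N ` V. \<forall>i<N. \<not> mid i y}"
    by auto
  also have "untwist N ` V = V"
    unfolding V_def by (rule untwist_image)
  finally have "untwist N ` (unbalanced \<inter> V) = {y \<in> V. \<forall>i<N. \<not> mid i y}" .
  then have card_eq: "card (unbalanced \<inter> V) = card {y \<in> V. \<forall>i<N. \<not> mid i y}"
    using card_image[OF inj_on_subset[OF inj_untwist subset_UNIV], of N "unbalanced \<inter> V"] by simp
  have "2 ^ p N = real (card V)"
    by (simp add: V_def card_below)
  also have "V = {y \<in> V. \<forall>i<N. \<not> mid i y} \<union> (\<Union>i<N. {y \<in> V. mid i y})"
    by auto
  also have "real (card \<dots>) \<le> real (card (unbalanced \<inter> V) + (\<Sum>i<N. card {y \<in> V. mid i y}))"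
    unfolding card_eq of_nat_le_iff
    by (intro order.trans[OF card_Un_le] add_left_mono card_UN_le) simp
  also have "\<dots> \<le> real (card (unbalanced \<inter> V)) + (\<Sum>i<N. \<delta> i * 2 ^ p N)"
    using mid_le by (auto intro!: sum_mono)
  finally have "(1 - (\<Sum>i<N. \<delta> i)) * 2 ^ p N \<le> real (card (unbalanced \<inter> V))"
    by (simp add: algebra_simps sum_distrib_right)
  then show ?thesis
    by (simp add: V_def card_below field_simps)
qed

lemma translate_jumps_intersective:
  assumes hits: "\<And>x k. \<exists>m. t m = x \<and> k \<le> r m"
  shows "chromatically_intersective (x +o jumps)"
  unfolding chromatically_intersective_def
proof (intro allI impI, elim conjE)
  fix P :: "F2_omega set set" assume fin: "finite P" and part: "partition_on UNIV P"
  obtain m where m: "t m = x" "card P \<le> r m"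
    using hits by blast
  define n where "n = card (block m)"
  obtain idx where idx: "bij_betw idx P {..<card P}"
    using ex_bij_betw_finite_nat[OF fin] by (auto simp: atLeast0LessThan)
  have "\<exists>A. A \<in> P \<and> y \<in> A" for y
    using partition_onD1[OF part] by blast
  then obtain cell where cell: "\<And>y. cell y \<in> P \<and> y \<in> cell y"
    by metis
  define vec where "vec U = vec_of ((+) (p m) ` U)" for U
  define c where "c U = idx (cell (vec U))" for U
  have "c U < card P" for U
    using bij_betwE[OF idx] cell by (auto simp: c_def)
  moreover have "card P \<le> n"
    using card_block_gt[of m] m(2) by (simp add: n_def)
  ultimately obtain U V where UV: "U \<subseteq> {..<n}" "V \<subseteq> {..<n}" "U \<inter> V = {}"
    "n < card U + card V + card P" "c U = c V"
    using nearly_complementary_monochromatic[of c "card P" n] by blast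
  define u where "u = vec U + vec V"
  have fin_UV: "finite U" "finite V"
    using UV(1,2) finite_subset by auto
  have "supp u = (+) (p m) ` (U \<union> V)"
    using fin_UV UV(3) by (auto simp: u_def vec_def supp_add)
  moreover have "card ((+) (p m) ` (U \<union> V)) = card U + card V"
    using fin_UV UV(3) by (simp add: card_image card_Un_disjoint)
  ultimately have card_u: "card (supp u) = card U + card V" and supp_u: "supp u \<subseteq> block m"
    using UV(1,2) by (auto simp: block_def n_def)
  have "u = x + (t m + u)"
    by (simp add: m(1))
  moreover have "t m + u \<in> jumps"
    unfolding jumps_def using supp_u card_u UV(4) m(2) n_def by fastforce
  ultimately have "u \<in> x +o jumps"
    unfolding elt_set_plus_def by blast
  moreover have "u \<in> difference_set (cell (vec U))"
  proof -
    have "cell (vec U) = cell (vec V)"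
      using UV(5) idx cell unfolding c_def bij_betw_def by (metis inj_onD)
    then have "vec V \<in> cell (vec U)"
      using cell[of "vec V"] by simp
    moreover have "u = vec U - vec V"
      by (simp only: u_def minus_F2)
    ultimately show ?thesis
      unfolding difference_set_def using cell[of "vec U"]
      by (intro CollectI exI[of _ "vec U"] exI[of _ "vec V"]) simp
  qed
  moreover have "u \<noteq> 0"
    using card_u UV(4) card_block_gt[of m] m(2) by (auto simp: n_def)
  ultimately show "\<exists>A\<in>P. \<exists>u\<in>difference_set A \<inter> (x +o jumps). u \<noteq> 0"
    using cell by blast
qed

end

section \<open>Choice of the blocks\<close>

text \<open>
  The radius of block \<open>m\<close> is \<open>m\<close>, and its length \<open>2 * k m\<close> is so large that a random subset of it is
  balanced with probability at most \<open>\<epsilon> / 2 ^ (m + 2)\<close>.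
\<close>
lemma ex_twisted_blocks:
  fixes \<epsilon> :: real
  assumes "\<epsilon> > 0"
  shows "\<exists>p r t. twisted_blocks p r t \<and> (\<forall>x k. \<exists>m. t m = x \<and> k \<le> r m) \<and>
    (\<forall>i. (2 * r i + 2) * real ((p (Suc i) - p i) choose ((p (Suc i) - p i) div 2))
            \<le> (\<epsilon> / 4) * (1 / 2) ^ i * 2 ^ (p (Suc i) - p i))"
proof -
  have "\<forall>m. \<exists>k\<ge>m + 1. (2 * m + 2) * real (2 * k choose k) \<le> (\<epsilon> / 4) * (1 / 2) ^ m * 2 ^ (2 * k)"
    using central_binomial_small[of "(\<epsilon> / 4) * (1 / 2) ^ _"] assms by simp
  then obtain k where k: "\<And>m. m + 1 \<le> k m"
    "\<And>m. (2 * m + 2) * real (2 * k m choose k m) \<le> (\<epsilon> / 4) * (1 / 2) ^ m * 2 ^ (2 * k m)"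
    by metis
  define p where "p m = (\<Sum>i<m. 2 * k i)" for m
  have p_Suc: "p (Suc m) - p m = 2 * k m" "p m + 2 * m + 1 < p (Suc m)" for m
    using k(1)[of m] by (simp_all add: p_def)
  have le_p: "m \<le> p m" for m
  proof (induction m)
    case (Suc m)
    then show ?case using p_Suc(2)[of m] by linarith
  qed simp
  (* The sequence e takes every vector as a value infinitely often.  Since p grows at least linearly, replacing
     by 0 the values that are not supported before block m loses no vector. *)
  define e where "e m = vec_of (set_decode (fst (prod_decode m)))" for m
  define t where "t m = (if e m \<in> below (p m) then e m else 0)" for m
  have "twisted_blocks p (\<lambda>m. m) t"
    by unfold_locales (use p_Suc(2) in \<open>auto simp: p_def t_def zero_below\<close>)
  moreover have "\<exists>m. t m = x \<and> K \<le> m" for x K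
  proof -
    obtain M where M: "x \<in> below M"
      using ex_below by blast
    define m where "m = prod_encode (set_encode (supp x), M + K)"
    have "M + K \<le> m"
      unfolding m_def by (rule le_prod_encode_2)
    have "e m = x"
      by (rule supp_inject) (simp add: e_def m_def)
    moreover have "x \<in> below (p m)"
      using M below_mono[of M "p m"] le_p[of m] \<open>M + K \<le> m\<close> by auto
    ultimately show ?thesis
      using \<open>M + K \<le> m\<close> by (intro exI[of _ m]) (simp add: t_def)
  qed
  ultimately show ?thesis
    using k(2) p_Suc(1) by (intro exI[of _ p] exI[of _ "\<lambda>m. m"] exI[of _ t]) simp
qed

theorem theorem1p7:
  fixes \<epsilon> :: real
  assumes "\<epsilon> > 0"
  shows "\<exists>S A :: F2_omega set.
           upper_banach_density A > ereal (1 - \<epsilon>) \<and>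
           (\<forall>t. chromatically_intersective (t +o S)) \<and>
           \<not> piecewise_syndetic (S + A)"
proof -
  obtain p r t where tb: "twisted_blocks p r t" and hits: "\<And>x k. \<exists>m. t m = x \<and> k \<le> r m"
    and small: "\<And>i. (2 * r i + 2) * real ((p (Suc i) - p i) choose ((p (Suc i) - p i) div 2))
            \<le> (\<epsilon> / 4) * (1 / 2) ^ i * 2 ^ (p (Suc i) - p i)"
    using ex_twisted_blocks[OF assms] by blast
  interpret twisted_blocks p r t by (rule tb)
  have block_small: "(2 * r i + 2) * real (card (block i) choose (card (block i) div 2))
      \<le> (\<epsilon> / 4) * (1 / 2) ^ i * 2 ^ card (block i)" for i
    using small[of i] by (simp add: block_def algebra_simps)
  have "1 - \<epsilon> / 2 \<le> real (card (unbalanced \<inter> below (p N))) / real (card (below (p N)))" for N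
  proof -
    have "(\<Sum>i<N. (1 / 2 :: real) ^ i) = 2 * (1 - (1 / 2) ^ N)"
      by (simp add: sum_gp_strict)
    then have "(\<Sum>i<N. (\<epsilon> / 4) * (1 / 2) ^ i) = (\<epsilon> / 4) * (2 * (1 - (1 / 2) ^ N))"
      by (simp only: sum_distrib_left[symmetric])
    also have "\<dots> \<le> \<epsilon> / 2"
      using assms by simp
    finally have "1 - \<epsilon> / 2 \<le> 1 - (\<Sum>i<N. (\<epsilon> / 4) * (1 / 2) ^ i)"
      by simp
    also have "\<dots> \<le> real (card (unbalanced \<inter> below (p N))) / real (card (below (p N)))"
      using block_small by (rule unbalanced_density)
    finally show ?thesis .
  qed
  then have "ereal (1 - \<epsilon> / 2) \<le> upper_banach_density unbalanced"
    by (rule upper_banach_density_ge[OF folner_below[OF strict_mono_p]])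
  moreover have "ereal (1 - \<epsilon>) < ereal (1 - \<epsilon> / 2)"
    using assms by simp
  ultimately have "ereal (1 - \<epsilon>) < upper_banach_density unbalanced"
    by (rule less_le_trans[rotated])
  then show ?thesis
    using translate_jumps_intersective[OF hits] not_piecewise_syndetic by blast
qed

end
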